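(* Let $\Gamma$ be a finitely generated non-elementary hyperbolic group equipped with a word metric, let $\mu$ be a finitely supported admissible probability measure on $\Gamma$, and let $\{x_n\}_{n\ge0}$ be the associated random walk starting at the identity. For every $a\in(0,1)$ there exists a subset $\Gamma_a\subset\Gamma$ such that $$\mathbb{P}\big(x_n\in\Gamma_a\text{ for all }n\ge0\big)\ge1-a\qquad\text{and}\qquad \lim_{n\to\infty}|\Gamma_a\cap S_n|^{1/n}=e^{h/l}.$$
   Context: $\Gamma$ is a finitely generated group, hyperbolic in the sense of Gromov and non-elementary (hence non-amenable). Fix a finite symmetric generating set; $|x|$ is the word length, $d(x,y)=|x^{-1}y|$ the word metric, $S_n$ the set of elements of word length exactly $n$. $\mu$ is admissible if its support generates $\Gamma$ as a semigroup; $\mu$ is not assumed symmetric. The random walk is $x_0=1$, $x_n=X_1\cdots X_n$, with $X_i$ independent of law $\mu$, and $\mathbb{P}$ is its law on path space; $\mu^{*n}$ is the law of $x_n$. The entropy and drift are $h=\lim_{n}-\frac1n\sum_{x}\mu^{*n}(x)\log\mu^{*n}(x)$ and $l=\lim_n\frac1n\sum_x|x|\mu^{*n}(x)$ (here $l>0$). *)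

theory Defs
  imports "HOL-Algebra.Coset" "HOL-Algebra.Generated_Groups" "HOL-Probability.Probability"
begin

definition list_prod :: "('a, 'b) monoid_scheme \<Rightarrow> 'a list \<Rightarrow> 'a" where
  "list_prod G w = foldr (\<otimes>\<^bsub>G\<^esub>) w \<one>\<^bsub>G\<^esub>"

definition finite_symmetric_generating :: "('a, 'b) monoid_scheme \<Rightarrow> 'a set \<Rightarrow> bool" where
  "finite_symmetric_generating G S \<longleftrightarrow>
     finite S \<and> S \<subseteq> carrier G \<and> (\<forall>s\<in>S. inv\<^bsub>G\<^esub> s \<in> S) \<and> generate G S = carrier G"

definition word_length :: "('a, 'b) monoid_scheme \<Rightarrow> 'a set \<Rightarrow> 'a \<Rightarrow> nat" where
  "word_length G S x = (LEAST n. \<exists>w. set w \<subseteq> S \<and> length w = n \<and> list_prod G w = x)"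

definition word_dist :: "('a, 'b) monoid_scheme \<Rightarrow> 'a set \<Rightarrow> 'a \<Rightarrow> 'a \<Rightarrow> real" where
  "word_dist G S x y = real (word_length G S (inv\<^bsub>G\<^esub> x \<otimes>\<^bsub>G\<^esub> y))"

definition word_sphere :: "('a, 'b) monoid_scheme \<Rightarrow> 'a set \<Rightarrow> nat \<Rightarrow> 'a set" where
  "word_sphere G S n = {x \<in> carrier G. word_length G S x = n}"

definition gromov_product :: "('a \<Rightarrow> 'a \<Rightarrow> real) \<Rightarrow> 'a \<Rightarrow> 'a \<Rightarrow> 'a \<Rightarrow> real" where
  "gromov_product d w x y = (d w x + d w y - d x y) / 2"

definition gromov_hyperbolic_on :: "'a set \<Rightarrow> ('a \<Rightarrow> 'a \<Rightarrow> real) \<Rightarrow> bool" where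
  "gromov_hyperbolic_on A d \<longleftrightarrow>
     (\<exists>\<delta>. \<forall>w\<in>A. \<forall>x\<in>A. \<forall>y\<in>A. \<forall>z\<in>A.
        gromov_product d w x z \<ge> min (gromov_product d w x y) (gromov_product d w y z) - \<delta>)"

text \<open>Hyperbolicity is a property of the group alone: the generating set that witnesses it need not
  be the one defining the word metric under consideration.\<close>

definition hyperbolic_group :: "('a, 'b) monoid_scheme \<Rightarrow> bool" where
  "hyperbolic_group G \<longleftrightarrow>
     (\<exists>S. finite_symmetric_generating G S \<and> gromov_hyperbolic_on (carrier G) (word_dist G S))"

text \<open>Elementary means virtually cyclic.  Finite groups are included, through the trivial
  subgroup.\<close>

definition elementary_group :: "('a, 'b) monoid_scheme \<Rightarrow> bool" where
  "elementary_group G \<longleftrightarrow> (\<exists>g\<in>carrier G. finite (rcosets\<^bsub>G\<^esub> (generate G {g})))"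

definition prob_on_group :: "('a, 'b) monoid_scheme \<Rightarrow> 'a pmf \<Rightarrow> bool" where
  "prob_on_group G \<mu> \<longleftrightarrow> set_pmf \<mu> \<subseteq> carrier G"

text \<open>The semigroup generated by the support consists of the products of nonempty words.\<close>

definition admissible :: "('a, 'b) monoid_scheme \<Rightarrow> 'a pmf \<Rightarrow> bool" where
  "admissible G \<mu> \<longleftrightarrow> {list_prod G w | w. w \<noteq> [] \<and> set w \<subseteq> set_pmf \<mu>} = carrier G"

primrec conv_power :: "('a, 'b) monoid_scheme \<Rightarrow> 'a pmf \<Rightarrow> nat \<Rightarrow> 'a pmf" where
  "conv_power G \<mu> 0 = return_pmf \<one>\<^bsub>G\<^esub>"
| "conv_power G \<mu> (Suc n) =
     map_pmf (\<lambda>(x, g). x \<otimes>\<^bsub>G\<^esub> g) (pair_pmf (conv_power G \<mu> n) \<mu>)"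

definition walk_entropy :: "('a, 'b) monoid_scheme \<Rightarrow> 'a pmf \<Rightarrow> real" where
  "walk_entropy G \<mu> = lim (\<lambda>n. - (1 / real n) *
     (\<Sum>\<^sub>\<infinity>x\<in>carrier G. pmf (conv_power G \<mu> n) x * ln (pmf (conv_power G \<mu> n) x)))"

definition walk_drift :: "('a, 'b) monoid_scheme \<Rightarrow> 'a set \<Rightarrow> 'a pmf \<Rightarrow> real" where
  "walk_drift G S \<mu> = lim (\<lambda>n. (1 / real n) *
     (\<Sum>\<^sub>\<infinity>x\<in>carrier G. real (word_length G S x) * pmf (conv_power G \<mu> n) x))"

text \<open>The increments live on the countable set \<open>carrier G\<close> and not on the whole type, which may be
  uncountable; there the product of discrete \<open>\<sigma>\<close>-algebras would be too coarse for the walk to be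
  measurable.  The increment called \<open>X 0\<close> here is the first one, so that the position at time
  \<open>n\<close> is \<open>X 0 \<otimes> \<dots> \<otimes> X (n - 1)\<close>.\<close>

definition increments :: "('a, 'b) monoid_scheme \<Rightarrow> 'a pmf \<Rightarrow> (nat \<Rightarrow> 'a) measure" where
  "increments G \<mu> = (\<Pi>\<^sub>M i\<in>UNIV. restrict_space (measure_pmf \<mu>) (carrier G))"

definition walk :: "('a, 'b) monoid_scheme \<Rightarrow> (nat \<Rightarrow> 'a) \<Rightarrow> nat \<Rightarrow> 'a" where
  "walk G X n = list_prod G (map X [0..<n])"

definition walk_law :: "('a, 'b) monoid_scheme \<Rightarrow> 'a pmf \<Rightarrow> (nat \<Rightarrow> 'a) measure" where
  "walk_law G \<mu> = distr (increments G \<mu>) (\<Pi>\<^sub>M n\<in>UNIV. count_space (carrier G)) (walk G)"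

end

theory Submission
  imports Defs "HOL-Real_Asymp.Real_Asymp"
begin

text \<open>
  Let \<open>h\<close> be the entropy, \<open>l\<close> the drift and \<open>S\<^sub>n\<close> the sphere of radius \<open>n\<close>.  At a large time \<open>n\<close> the walk
  lies, up to an exponentially small probability, in the set of atoms of its law of weight at least
  \<open>exp (- n (h + \<epsilon>))\<close>; there are at most \<open>exp (n (h + \<epsilon>))\<close> of them.  Moreover its distance from the
  identity is at least \<open>(l - \<epsilon>) n\<close>, so that it can only meet \<open>S\<^sub>m\<close> at times \<open>n \<le> m / (l - \<epsilon>)\<close>.
  Imposing both conditions from suitable times on, with smaller and smaller \<open>\<epsilon>\<close>, gives a set that
  contains the whole walk with probability at least \<open>1 - a\<close> (\<open>exists_confined\<close>) and that has at most
  \<open>exp (m (h / l + o(1)))\<close> elements on \<open>S\<^sub>m\<close> (\<open>card_confined\<close>).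

  The matching lower bound is obtained by enlarging the set.  By submultiplicativity each
  sphere \<open>S\<^sub>m\<close> has at least \<open>exp (m v)\<close> elements, where \<open>v\<close> is the growth rate, and the fundamental
  inequality \<open>h \<le> l v\<close> shows that it contains \<open>exp (m h / l)\<close> elements, which are added to the set
  (\<open>card_word_sphere_ge\<close>, \<open>exists_growth_set\<close>).

  Three facts about the walk remain.  The concentration of the entropy (\<open>summable_not_typical\<close>) only
  concerns the laws: the sums of the powers \<open>1 - \<theta>\<close> of their weights are submultiplicative, and for
  small \<open>\<theta>\<close> they are governed by the entropy.  The almost sure lower bound for the speed
  (\<open>AE_speed_ge\<close>) is the difficult half of the subadditive ergodic theorem; as the increments are
  independent, Kolmogorov's zero-one law replaces ergodicity, and if the walk had speed less than
  \<open>c < l\<close> infinitely often, covering a long time interval by blocks of speed less than \<open>c\<close>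
  (\<open>len_block_covering\<close>) would force the drift to be at most \<open>c\<close>.

  Finally \<open>l > 0\<close> (\<open>hyperbolic_walk_drift_pos\<close>), which is where hyperbolicity enters.  A hyperbolic
  group that is not virtually cyclic has three long elements pointing in pairwise different
  directions: otherwise all elements would stay near the axis of one loxodromic element
  (\<open>exists_three_directions\<close>).  Going from any point in two of three directions that lead
  away from the identity, \<open>k\<close> times in a row, reaches \<open>2 ^ k\<close> points, whereas a point is reached in this
  manner only from the neighbourhood of a geodesic, that is from a number of points linear in \<open>k\<close>.
  Therefore no summable function is almost invariant (\<open>nonamenable\<close>).  Applied to sums of squares of
  the laws over a window of times, this makes their square sums decay exponentially
  (\<open>energy_contraction\<close>); then all probabilities at time \<open>n\<close> are exponentially small, and the walk must
  leave balls of radius proportional to \<open>n\<close>, because these have only exponentially many elements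
  (\<open>mean_len_ge\<close>).
\<close>

section \<open>Word metrics\<close>

locale word_metric = group G for G (structure) +
  fixes S :: "'a set"
  assumes generating: "finite_symmetric_generating G S"
begin

abbreviation len :: "'a \<Rightarrow> nat" where
  "len \<equiv> word_length G S"

lemma S_carrier: "S \<subseteq> carrier G" and S_finite: "finite S" and S_inv: "s \<in> S \<Longrightarrow> inv s \<in> S"
  using generating by (auto simp: finite_symmetric_generating_def)

lemma list_prod_Nil [simp]: "list_prod G [] = \<one>"
  and list_prod_Cons [simp]: "list_prod G (x # w) = x \<otimes> list_prod G w"
  by (simp_all add: list_prod_def)

lemma list_prod_closed [simp, intro]: "set w \<subseteq> carrier G \<Longrightarrow> list_prod G w \<in> carrier G"
  by (induction w) auto

lemma list_prod_append:
  "set v \<subseteq> carrier G \<Longrightarrow> set w \<subseteq> carrier G \<Longrightarrow>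
    list_prod G (v @ w) = list_prod G v \<otimes> list_prod G w"
  by (induction v) (auto simp: m_assoc)

lemma list_prod_rev_inv:
  "set w \<subseteq> carrier G \<Longrightarrow> list_prod G (rev (map (m_inv G) w)) = inv (list_prod G w)"
proof (induction w)
  case (Cons x w)
  then have "set (rev (map (m_inv G) w)) \<subseteq> carrier G" "set [inv x] \<subseteq> carrier G" by auto
  from list_prod_append[OF this] show ?case using Cons by (simp add: inv_mult_group)
qed simp

lemma generated_word:
  assumes "x \<in> carrier G"
  shows "\<exists>w. set w \<subseteq> S \<and> list_prod G w = x"
proof -
  have "x \<in> generate G S"
    using assms generating by (simp add: finite_symmetric_generating_def)
  then show ?thesis
  proof induction
    case one
    show ?case by (intro exI[of _ "[]"]) simp
  next
    case (incl h)
    then show ?case using S_carrier by (intro exI[of _ "[h]"]) auto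
  next
    case (inv h)
    then show ?case using S_carrier S_inv by (intro exI[of _ "[inv h]"]) auto
  next
    case (eng h1 h2)
    then obtain v w where "set v \<subseteq> S" "list_prod G v = h1" "set w \<subseteq> S" "list_prod G w = h2"
      by blast
    then show ?case
      using S_carrier by (intro exI[of _ "v @ w"]) (auto simp: list_prod_append)
  qed
qed

lemma len_le_length: "set w \<subseteq> S \<Longrightarrow> len (list_prod G w) \<le> length w"
  unfolding word_length_def by (rule Least_le) blast

lemma geodesic_word:
  assumes "x \<in> carrier G"
  obtains w where "set w \<subseteq> S" "length w = len x" "list_prod G w = x"
proof -
  have "\<exists>n w. set w \<subseteq> S \<and> length w = n \<and> list_prod G w = x"
    using generated_word[OF assms] by blast
  from LeastI_ex[OF this] obtain w where "set w \<subseteq> S" "length w = len x" "list_prod G w = x"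
    unfolding word_length_def by blast
  then show ?thesis by (rule that)
qed

lemma len_one [simp]: "len \<one> = 0"
  using len_le_length[of "[]"] by simp

lemma len_eq_0:
  assumes "x \<in> carrier G" "len x = 0"
  shows "x = \<one>"
proof -
  obtain w where "set w \<subseteq> S" "length w = len x" "list_prod G w = x"
    using assms(1) by (rule geodesic_word)
  then show ?thesis using assms(2) by auto
qed

lemma len_mult:
  assumes "x \<in> carrier G" "y \<in> carrier G"
  shows "len (x \<otimes> y) \<le> len x + len y"
proof -
  obtain v where v: "set v \<subseteq> S" "length v = len x" "list_prod G v = x"
    using assms(1) by (rule geodesic_word)
  obtain w where w: "set w \<subseteq> S" "length w = len y" "list_prod G w = y"
    using assms(2) by (rule geodesic_word)
  have "list_prod G (v @ w) = x \<otimes> y"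
    using v w S_carrier by (simp add: list_prod_append)
  then show ?thesis
    using len_le_length[of "v @ w"] v w by simp
qed

lemma len_inv [simp]:
  assumes "x \<in> carrier G"
  shows "len (inv x) = len x"
proof -
  have le: "len (inv y) \<le> len y" if y: "y \<in> carrier G" for y
  proof -
    obtain v where v: "set v \<subseteq> S" "length v = len y" "list_prod G v = y"
      using y by (rule geodesic_word)
    have "set (rev (map (m_inv G) v)) \<subseteq> S"
      using v S_inv by auto
    from len_le_length[OF this] show ?thesis
      using v S_carrier by (simp add: list_prod_rev_inv)
  qed
  show ?thesis
    using le[OF assms] le[of "inv x"] assms by simp
qed

lemma len_list_prod_le:
  "set w \<subseteq> carrier G \<Longrightarrow> (\<And>s. s \<in> set w \<Longrightarrow> len s \<le> K) \<Longrightarrow> len (list_prod G w) \<le> K * length w"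
proof (induction w)
  case (Cons s w)
  have "len (s \<otimes> list_prod G w) \<le> len s + len (list_prod G w)"
    using Cons.prems by (intro len_mult) auto
  also have "\<dots> \<le> K + K * length w"
    using Cons by (intro add_mono) auto
  finally show ?case by simp
qed simp

lemma len_split:
  assumes "x \<in> carrier G" "k \<le> len x"
  obtains y z where "y \<in> carrier G" "z \<in> carrier G" "x = y \<otimes> z" "len y = k" "len z = len x - k"
proof -
  obtain w where w: "set w \<subseteq> S" "length w = len x" "list_prod G w = x"
    using assms(1) by (rule geodesic_word)
  define y z where "y = list_prod G (take k w)" and "z = list_prod G (drop k w)"
  have sub: "set (take k w) \<subseteq> S" "set (drop k w) \<subseteq> S"
    using w(1) set_take_subset[of k w] set_drop_subset[of k w] by blast+
  then have sub': "set (take k w) \<subseteq> carrier G" "set (drop k w) \<subseteq> carrier G"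
    using S_carrier by blast+
  have x: "x = y \<otimes> z"
    using list_prod_append[OF sub'] w(3) unfolding y_def z_def by simp
  have c: "y \<in> carrier G" "z \<in> carrier G"
    unfolding y_def z_def by (rule list_prod_closed, fact)+
  have "len y \<le> k" "len z \<le> len x - k"
    using len_le_length[OF sub(1)] len_le_length[OF sub(2)] w(2) assms(2)
    unfolding y_def z_def by auto
  moreover have "len x \<le> len y + len z" using x c len_mult by simp
  ultimately have "len y = k" "len z = len x - k" using assms by linarith+
  then show ?thesis using that x c by blast
qed

definition ball :: "nat \<Rightarrow> 'a set" where
  "ball n = {x \<in> carrier G. len x \<le> n}"

lemma ball_subset_words: "ball n \<subseteq> list_prod G ` {w. set w \<subseteq> S \<and> length w \<le> n}"
proof
  fix x assume "x \<in> ball n"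
  then have x: "x \<in> carrier G" "len x \<le> n" by (auto simp: ball_def)
  from x(1) obtain w where "set w \<subseteq> S" "length w = len x" "list_prod G w = x"
    by (rule geodesic_word)
  with x show "x \<in> list_prod G ` {w. set w \<subseteq> S \<and> length w \<le> n}" by auto
qed

lemma finite_ball [simp]: "finite (ball n)"
  by (rule finite_subset[OF ball_subset_words]) (simp add: S_finite finite_lists_length_le)

lemma card_ball_le: "card (ball n) \<le> (card S + 1) ^ n"
proof -
  have "card (ball n) \<le> card {w. set w \<subseteq> S \<and> length w \<le> n}"
    by (rule surj_card_le[OF _ ball_subset_words]) (simp add: S_finite finite_lists_length_le)
  also have "\<dots> = (\<Sum>i\<le>n. card S ^ i)"
    by (simp add: S_finite card_lists_length_le)
  also have "\<dots> \<le> (card S + 1) ^ n"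
  proof (induction n)
    case (Suc n)
    have "card S * card S ^ n \<le> card S * (card S + 1) ^ n"
      by (intro mult_left_mono power_mono) auto
    with Suc have "(\<Sum>i\<le>n. card S ^ i) + card S * card S ^ n
        \<le> (card S + 1) ^ n + card S * (card S + 1) ^ n"
      by (rule add_mono)
    then show ?case by simp
  qed simp
  finally show ?thesis .
qed

lemma ball_carrier: "ball n \<subseteq> carrier G"
  by (auto simp: ball_def)

lemma word_sphere_subset_ball: "word_sphere G S n \<subseteq> ball n"
  by (auto simp: ball_def word_sphere_def)

lemma finite_word_sphere [simp]: "finite (word_sphere G S n)"
  by (rule finite_subset[OF word_sphere_subset_ball finite_ball])

lemma unbounded_len:
  assumes "infinite (carrier G)"
  obtains x where "x \<in> carrier G" "len x = n"
proof -
  have "\<not> carrier G \<subseteq> ball n"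
    using assms finite_subset finite_ball by blast
  then obtain x where x: "x \<in> carrier G" "\<not> len x \<le> n" by (auto simp: ball_def)
  then have "n \<le> len x" by simp
  from len_split[OF x(1) this] that show ?thesis by blast
qed

end

section \<open>Hyperbolic word metrics\<close>

lemma (in group) finite_imp_elementary:
  assumes "finite (carrier G)"
  shows "elementary_group G"
proof -
  have "rcosets (generate G {\<one>}) \<subseteq> Pow (carrier G)"
    using r_coset_subset_G generate_incl[of "{\<one>}"] by (auto simp: RCOSETS_def)
  then have "finite (rcosets (generate G {\<one>}))"
    by (rule finite_subset) (simp add: assms)
  then show ?thesis unfolding elementary_group_def by blast
qed

context word_metric
begin

text \<open>The Gromov product based at the identity.  Left translations reduce every other base point to
  this one.\<close>

definition gp :: "'a \<Rightarrow> 'a \<Rightarrow> real" where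
  "gp x y = (real (len x) + real (len y) - real (len (inv x \<otimes> y))) / 2"

lemma gp_nonneg: "x \<in> carrier G \<Longrightarrow> y \<in> carrier G \<Longrightarrow> 0 \<le> gp x y"
  using len_mult[of "inv x" y] by (simp add: gp_def)

lemma len_inv_mult_commute:
  assumes "x \<in> carrier G" "y \<in> carrier G"
  shows "len (inv x \<otimes> y) = len (inv y \<otimes> x)"
  using len_inv[of "inv x \<otimes> y"] assms by (simp add: inv_mult_group)

lemma gp_commute:
  assumes "x \<in> carrier G" "y \<in> carrier G"
  shows "gp x y = gp y x"
  using len_inv_mult_commute[OF assms] by (simp add: gp_def)

text \<open>Moving the base point along a segment: seen from \<open>s\<close>, the elements \<open>x\<close> and \<open>\<one>\<close> become
  \<open>inv s \<otimes> x\<close> and \<open>inv s\<close>, and in a tree the two products measure complementary parts of the segment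
  from \<open>\<one>\<close> to \<open>s\<close>.\<close>

lemma gp_shift:
  assumes "s \<in> carrier G" "x \<in> carrier G"
  shows "gp (inv s \<otimes> x) (inv s) + gp x s = len s"
proof -
  have "inv (inv s \<otimes> x) \<otimes> inv s = inv x"
    using assms by (simp add: inv_mult_group m_assoc)
  moreover have "len (inv s \<otimes> x) = len (inv x \<otimes> s)"
    using assms by (intro len_inv_mult_commute)
  ultimately show ?thesis
    using assms by (simp add: gp_def field_simps)
qed

lemma gp_mult:
  assumes "s \<in> carrier G" "t \<in> carrier G"
  shows "gp t (inv s) + gp (s \<otimes> t) s = len s"
  using gp_shift[of s "s \<otimes> t"] assms by (simp add: m_assoc[symmetric])

lemma len_mult_gp:
  assumes "s \<in> carrier G" "t \<in> carrier G"
  shows "real (len (s \<otimes> t)) = len s + len t - 2 * gp (inv s) t"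
  using assms by (simp add: gp_def field_simps)

end

locale hyperbolic_word_metric = word_metric +
  fixes \<delta> :: real
  assumes delta_nonneg: "0 \<le> \<delta>"
    and four_point: "\<And>x y z. x \<in> carrier G \<Longrightarrow> y \<in> carrier G \<Longrightarrow> z \<in> carrier G \<Longrightarrow>
      min (gp x y) (gp y z) \<le> gp x z + \<delta>"
begin

lemma gp_le_of_left:
  assumes "x \<in> carrier G" "y \<in> carrier G" "z \<in> carrier G" "gp x z \<le> c" "c + \<delta> < gp x y"
  shows "gp y z \<le> c + \<delta>"
  using four_point[OF assms(1-3)] assms(4-5) by linarith

lemma gp_le_of_right:
  assumes "x \<in> carrier G" "y \<in> carrier G" "z \<in> carrier G" "gp x z \<le> c" "c + \<delta> < gp y z"
  shows "gp x y \<le> c + \<delta>"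
  using four_point[OF assms(1-3)] assms(4-5) by linarith

text \<open>An infinite hyperbolic group contains elements that translate a long way along an axis:
  their Gromov product with their inverse is bounded while their length is not.
  Cutting a long geodesic in the middle gives two elements \<open>u\<close>, \<open>v\<close> pointing in opposite directions.
  If \<open>u\<close> points in the same direction as \<open>inv u\<close> and likewise for \<open>v\<close>, then \<open>u \<otimes> v\<close> starts in the
  direction of \<open>u\<close> and its inverse in the direction of \<open>v\<close>.\<close>

lemma exists_loxodromic:
  assumes "infinite (carrier G)"
  obtains g where "g \<in> carrier G" "gp g (inv g) \<le> 3 * \<delta> + 1" "N \<le> len g"
proof -
  \<comment> \<open>The half length: all comparisons below need a margin of a few \<open>\<delta>\<close>.\<close>
  define n where "n = max N (nat \<lceil>4 * \<delta> + 2\<rceil> + N)"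
  have n: "N \<le> n" "4 * \<delta> + 2 + N \<le> n"
    unfolding n_def by linarith+
  obtain x where x: "x \<in> carrier G" "len x = 2 * n"
    using assms by (rule unbounded_len)
  obtain y v where yv: "y \<in> carrier G" "v \<in> carrier G" "x = y \<otimes> v" "len y = n" "len v = len x - n"
    by (rule len_split[OF x(1), of n]) (use x(2) in auto)
  define u where "u = inv y"
  have u: "u \<in> carrier G" "len u = n" "inv u = y" "y \<in> carrier G" and v: "v \<in> carrier G" "len v = n"
    using yv x(2) by (auto simp: u_def)
  have uv: "gp u v = 0"
    using u v x yv by (simp add: gp_def)
  show ?thesis
  proof (cases "gp u (inv u) \<le> 2 * \<delta> + 1 \<or> gp v (inv v) \<le> 2 * \<delta> + 1")
    case True
    then show ?thesis
      using that[of u] that[of v] u v n delta_nonneg by auto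
  next
    case False
    have 1: "gp (inv u) v \<le> 0 + \<delta>"
      by (rule gp_le_of_left[of u]) (use False u v uv delta_nonneg in auto)
    have 2: "gp u (inv v) \<le> 0 + \<delta>"
      by (rule gp_le_of_right[of _ _ v]) (use False u v uv delta_nonneg gp_commute[of v "inv v"] in auto)
    define g where "g = u \<otimes> v"
    have g: "g \<in> carrier G" "inv g = inv v \<otimes> inv u"
      using u v by (auto simp: g_def inv_mult_group)
    have 3: "len g \<ge> 2 * n - 2 * \<delta>"
      using len_mult_gp[OF u(1) v(1)] 1 u v by (simp add: g_def)
    have 4: "gp g u \<ge> n - \<delta>"
      using gp_mult[OF u(1) v(1)] 1 u v gp_commute[of v "inv u"] by (simp add: g_def)
    have 5: "gp (inv g) (inv v) \<ge> n - \<delta>"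
      using gp_mult[of "inv v" "inv u"] 1 u v gp_commute[of v "inv u"] g by simp
    have 6: "gp g (inv v) \<le> \<delta> + \<delta>"
      by (rule gp_le_of_left[of u]) (use 2 4 u v g n gp_commute[of u g] in auto)
    have "gp g (inv g) \<le> 2 * \<delta> + \<delta>"
      by (rule gp_le_of_right[of _ _ "inv v"]) (use 5 6 u v g n in auto)
    moreover have "N \<le> len g"
      using 3 n delta_nonneg by linarith
    ultimately show ?thesis using that[of g] g by auto
  qed
qed

text \<open>For such an element the powers form a quasi-geodesic line: each further factor keeps the
  Gromov product at the last vertex bounded, so that no length is lost beyond a constant per step.\<close>

lemma loxodromic_powers:
  fixes C :: real and k :: nat
  assumes g: "g \<in> carrier G" "gp g (inv g) \<le> C" "2 * C + 4 * \<delta> + 1 \<le> len g"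
  shows "gp (inv g) (g [^] Suc k) \<le> C + \<delta>"
    and "len g - C - \<delta> \<le> gp g (g [^] Suc k)"
    and "k \<le> len (g [^] k)"
proof -
  have pow: "g [^] Suc n = g \<otimes> g [^] n" for n :: nat
    using g(1) nat_pow_Suc2 by blast
  have far: "gp g (g [^] Suc n) = len g - gp (inv g) (g [^] n)" for n :: nat
    using gp_mult[of g "g [^] n"] g(1)
      gp_commute[of "g [^] Suc n" g] gp_commute[of "g [^] n" "inv g"]
    unfolding pow by simp
  have C: "0 \<le> C"
    using g gp_def[of g "inv g"] len_mult[of "inv g" "inv g"] by simp
  have bounded: "gp (inv g) (g [^] n) \<le> C + \<delta>" for n :: nat
  proof (induction n)
    case 0
    then show ?case using g C delta_nonneg by (simp add: gp_def)
  next
    case (Suc n)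
    have "gp (g [^] Suc n) (inv g) \<le> C + \<delta>"
      by (rule gp_le_of_left[of g]) (use g Suc far[of n] delta_nonneg in \<open>auto simp del: nat_pow_Suc\<close>)
    then show ?case
      using g gp_commute[of "g [^] Suc n" "inv g"] by (simp del: nat_pow_Suc)
  qed
  show "gp (inv g) (g [^] Suc k) \<le> C + \<delta>" by (rule bounded)
  show "len g - C - \<delta> \<le> gp g (g [^] Suc k)" using far[of k] bounded[of k] by linarith
  show "k \<le> len (g [^] k)"
  proof (induction k)
    case (Suc k)
    have "real (len (g [^] Suc k)) = len g + len (g [^] k) - 2 * gp (inv g) (g [^] k)"
      unfolding pow using g by (intro len_mult_gp) auto
    then have "real (len (g [^] Suc k)) \<ge> 1 + len (g [^] k)"
      using bounded[of k] g(3) delta_nonneg by linarith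
    then show ?case using Suc by linarith
  qed simp
qed

text \<open>Three directions at a common scale.  The lengths exceed the products so much that the choice of
  one of the elements remains visible after any continuation that does not backtrack.\<close>

definition three_directions :: "real \<Rightarrow> 'a \<Rightarrow> 'a \<Rightarrow> 'a \<Rightarrow> bool" where
  "three_directions C x y z \<longleftrightarrow> x \<in> carrier G \<and> y \<in> carrier G \<and> z \<in> carrier G \<and>
     gp x y \<le> C \<and> gp y z \<le> C \<and> gp x z \<le> C \<and>
     2 * C + 5 * \<delta> < len x \<and> 2 * C + 5 * \<delta> < len y \<and> 2 * C + 5 * \<delta> < len z"

text \<open>If neither neighbour of the identity on the axis of \<open>g\<close> is closer to \<open>x\<close> than the identity is,
  then \<open>x\<close> leaves the axis at the identity, up to a bounded error: its products with \<open>g\<close> and \<open>inv g\<close>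
  are at most half the length of \<open>g\<close>, and far powers of \<open>g\<close> lie in the same directions as these.\<close>

lemma transversal_to_axis:
  fixes C :: real and k :: nat
  assumes g: "g \<in> carrier G" "gp g (inv g) \<le> C" "2 * C + 4 * \<delta> + 1 \<le> len g"
    and x: "x \<in> carrier G" "len x \<le> len (inv g \<otimes> x)" "len x \<le> len (g \<otimes> x)"
    and long: "len g + 7 * \<delta> < len x"
  shows "\<exists>y z. three_directions (len g / 2 + \<delta>) x y z"
proof -
  define h where "h = inv g"
  have h: "h \<in> carrier G" "gp h (inv h) \<le> C" "2 * C + 4 * \<delta> + 1 \<le> len h" "len h = len g" "inv h = g"
    using g gp_commute[of g "inv g"] by (auto simp: h_def)
  \<comment> \<open>For \<open>C = len g / 2 + \<delta>\<close> the required length \<open>2 * C + 5 * \<delta>\<close> is \<open>len g + 7 * \<delta>\<close>.\<close>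
  define n where "n = nat \<lceil>len g + 7 * \<delta>\<rceil>"
  define y z where "y = g [^] Suc n" and "z = h [^] Suc n"
  note pg = loxodromic_powers[OF g] and ph = loxodromic_powers[OF h(1-3)]
  have yz: "y \<in> carrier G" "z \<in> carrier G" using g h by (auto simp: y_def z_def)
  have len_yz: "len g + 7 * \<delta> < len y" "len g + 7 * \<delta> < len z"
    using pg(3)[of "Suc n"] ph(3)[of "Suc n"] unfolding y_def z_def n_def by linarith+
  have pg2: "len g - C - \<delta> \<le> gp g y" and ph2: "len g - C - \<delta> \<le> gp h z"
    using pg(2)[of n] ph(2)[of n] h(4) unfolding y_def z_def by simp_all
  have xg: "gp x g \<le> len g / 2" "gp x h \<le> len g / 2"
    using x(2,3) len_inv_mult_commute[OF x(1) g(1)] len_inv_mult_commute[OF x(1) h(1)] h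
    by (auto simp: gp_def h_def)
  have xy: "gp x y \<le> len g / 2 + \<delta>"
    by (rule gp_le_of_right[of _ _ g])
      (use xg x g yz pg2 gp_commute[of g y] delta_nonneg in auto)
  have xz: "gp x z \<le> len g / 2 + \<delta>"
    by (rule gp_le_of_right[of _ _ h])
      (use xg x h g yz ph2 gp_commute[of h z] delta_nonneg in auto)
  have "gp h y \<le> C + \<delta>" 
    using pg(1)[of n] unfolding y_def h_def .
  then have "gp z y \<le> C + \<delta> + \<delta>"
    by (rule gp_le_of_left[of h, rotated 3])
      (use h yz ph2 delta_nonneg in auto)
  then have "gp y z \<le> len g / 2 + \<delta>"
    using yz gp_commute[of y z] g(3) delta_nonneg by linarith
  then show ?thesis
    unfolding three_directions_def using xy xz yz x len_yz long
    by (intro exI[of _ y] exI[of _ z]) auto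
qed

text \<open>If there are no three directions, every element stays near the axis of a loxodromic element
  \<open>g\<close>, so that the cyclic subgroup generated by \<open>g\<close> has finite index.\<close>

lemma exists_three_directions:
  assumes "\<not> elementary_group G"
  shows "\<exists>C x y z. three_directions C x y z"
proof (rule ccontr)
  assume no: "\<not> ?thesis"
  have inf: "infinite (carrier G)" using assms finite_imp_elementary by blast
  define C where "C = 3 * \<delta> + 1"
  obtain g where g: "g \<in> carrier G" "gp g (inv g) \<le> C" and long: "nat \<lceil>2 * C + 4 * \<delta> + 1\<rceil> \<le> len g"
    using exists_loxodromic[OF inf] unfolding C_def by metis
  have long': "2 * C + 4 * \<delta> + 1 \<le> len g" using long by linarith
  define K where "K = nat \<lfloor>len g + 7 * \<delta>\<rfloor>"
  let ?H = "generate G {g}"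
  have H: "subgroup ?H G" using g by (intro generate_is_subgroup) auto
  \<comment> \<open>Translating \<open>x\<close> by the element of the cyclic group that makes it shortest brings its closest
    point on the axis to the identity.\<close>
  have near: "\<exists>h\<in>?H. h \<otimes> x \<in> ball K" if x: "x \<in> carrier G" for x
  proof -
    define m where "m = (LEAST m. \<exists>h\<in>?H. len (h \<otimes> x) = m)"
    have "\<exists>m. \<exists>h\<in>?H. len (h \<otimes> x) = m" using subgroup.one_closed[OF H] by blast
    from LeastI_ex[OF this] obtain h where h: "h \<in> ?H" "len (h \<otimes> x) = m"
      unfolding m_def by blast
    have least: "m \<le> len (k \<otimes> x)" if "k \<in> ?H" for k
      unfolding m_def by (rule Least_le) (use that in blast)
    have gH: "g \<in> ?H" "inv g \<in> ?H"
      using generate.incl[of g "{g}" G] subgroup.m_inv_closed[OF H] by auto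
    have hc: "h \<in> carrier G" using h(1) H subgroup.mem_carrier by fast
    define z where "z = h \<otimes> x"
    have z: "z \<in> carrier G" using hc x by (simp add: z_def)
    have "m \<le> len (g \<otimes> z)" "m \<le> len (inv g \<otimes> z)"
      using least[of "g \<otimes> h"] least[of "inv g \<otimes> h"] subgroup.m_closed[OF H] gH h(1) hc x g(1)
      by (auto simp: z_def m_assoc)
    then have "\<not> len g + 7 * \<delta> < len z"
      using transversal_to_axis[OF g long' z] no h(2) unfolding z_def by blast
    then have "z \<in> ball K" using z unfolding ball_def K_def by simp linarith
    then show ?thesis using h(1) z_def by blast
  qed
  have "rcosets ?H \<subseteq> (\<lambda>b. ?H #> b) ` ball K"
  proof
    fix X assume "X \<in> rcosets ?H"
    then obtain x where x: "x \<in> carrier G" "X = ?H #> x" by (auto simp: RCOSETS_def)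
    obtain h where h: "h \<in> ?H" "h \<otimes> x \<in> ball K" using near x by blast
    have "?H #> (h \<otimes> x) = ?H #> x"
      using repr_independence[of "h \<otimes> x" ?H x] x(1) h(1) H
      by (auto simp: r_coset_def)
    then show "X \<in> (\<lambda>b. ?H #> b) ` ball K" using x h(2) by auto
  qed
  then have "finite (rcosets ?H)" by (rule finite_subset) simp
  with assms g show False unfolding elementary_group_def by blast
qed

end

section \<open>Non-amenability\<close>

lemma linear_less_power2: "\<exists>k::nat. (k * a + 1) * b < 2 ^ k"
proof -
  have "((\<lambda>k::nat. ((real k * A + 1) * B) / 2 ^ k) \<longlongrightarrow> 0) at_top" for A B :: real
    by real_asymp
  from order_tendstoD(2)[OF this[of "real a" "real b"] zero_less_one]
  obtain k where "((real k * real a + 1) * real b) / 2 ^ k < 1"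
    by (auto simp: eventually_sequentially)
  then have "real ((k * a + 1) * b) < real (2 ^ k)" by (simp add: algebra_simps)
  then show ?thesis unfolding of_nat_less_iff by blast
qed

context group
begin

text \<open>Sums over the group are taken in \<open>ennreal\<close>, where they exist and may be exchanged without any
  condition of summability.\<close>

abbreviation mass :: "('a \<Rightarrow> real) \<Rightarrow> ennreal" where
  "mass F \<equiv> \<integral>\<^sup>+x. ennreal (F x) \<partial>count_space (carrier G)"

lemma bij_rmult: "g \<in> carrier G \<Longrightarrow> bij_betw (\<lambda>x. x \<otimes> g) (carrier G) (carrier G)"
  by (intro bij_betw_byWitness[where f' = "\<lambda>x. x \<otimes> inv g"]) (auto simp: m_assoc)

lemmas mass_rmult = nn_integral_bij_count_space[OF bij_rmult]

lemma mass_add: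
  "(\<And>x. x \<in> carrier G \<Longrightarrow> 0 \<le> F x) \<Longrightarrow> (\<And>x. x \<in> carrier G \<Longrightarrow> 0 \<le> H x) \<Longrightarrow>
    mass (\<lambda>x. F x + H x) = mass F + mass H"
  by (subst nn_integral_add[symmetric]) (auto intro!: nn_integral_cong)

lemma mass_sum:
  "(\<And>i x. i \<in> I \<Longrightarrow> x \<in> carrier G \<Longrightarrow> 0 \<le> F i x) \<Longrightarrow>
    mass (\<lambda>x. \<Sum>i\<in>I. F i x) = (\<Sum>i\<in>I. mass (F i))"
  by (subst nn_integral_sum[symmetric]) (auto intro!: nn_integral_cong simp: sum_ennreal)

lemma mass_mono: "(\<And>x. x \<in> carrier G \<Longrightarrow> F x \<le> H x) \<Longrightarrow> mass F \<le> mass H"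
  by (intro nn_integral_mono ennreal_leI) auto

lemma mass_cmult: "0 \<le> c \<Longrightarrow> mass (\<lambda>x. c * F x) = ennreal c * mass F"
  by (subst nn_integral_cmult[symmetric]) (auto intro!: nn_integral_cong simp: ennreal_mult')

end

context hyperbolic_word_metric
begin

text \<open>If two of the directions were close to that of \<open>a\<close>, they would be close to each other.\<close>

lemma two_good_directions:
  assumes "three_directions C s1 s2 s3" "a \<in> carrier G"
  obtains s s' where "s \<in> {s1, s2, s3}" "s' \<in> {s1, s2, s3}" "gp s s' \<le> C"
    "gp a s \<le> C + \<delta>" "gp a s' \<le> C + \<delta>"
proof -
  have s: "s1 \<in> carrier G" "s2 \<in> carrier G" "s3 \<in> carrier G" "gp s1 s2 \<le> C" "gp s2 s3 \<le> C" "gp s1 s3 \<le> C"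
    using assms(1) by (simp_all add: three_directions_def)
  have two: "gp a x \<le> C + \<delta> \<or> gp a y \<le> C + \<delta>" if "x \<in> carrier G" "y \<in> carrier G" "gp x y \<le> C" for x y
    using four_point[of x a y] that assms(2) gp_commute[of x a] by linarith
  consider "gp a s1 \<le> C + \<delta>" "gp a s2 \<le> C + \<delta>" | "gp a s2 \<le> C + \<delta>" "gp a s3 \<le> C + \<delta>"
    | "gp a s1 \<le> C + \<delta>" "gp a s3 \<le> C + \<delta>"
    using two[OF s(1,2,4)] two[OF s(2,3,5)] two[OF s(1,3,6)] by linarith
  then show ?thesis
  proof cases
    case 1
    then show ?thesis using that[of s1 s2] s by simp
  next
    case 2
    then show ?thesis using that[of s2 s3] s by simp
  next
    case 3
    then show ?thesis using that[of s1 s3] s by simp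
  qed
qed

text \<open>Think of \<open>a\<close> as the identity seen from the present position \<open>inv a\<close>.  Iterating the choice between
  two directions that do not lead back to it gives exponentially many displacements.  The extra
  condition \<open>gp r t\<close> in the induction step remembers the first choice \<open>r\<close>: displacements with different
  first choices are different, because the two directions have a small product.\<close>

lemma many_continuations:
  assumes dirs: "three_directions C s1 s2 s3" and "a \<in> carrier G"
  shows "\<exists>W \<subseteq> carrier G. finite W \<and> 2 ^ k \<le> card W \<and>
    (\<forall>t\<in>W. gp a t \<le> C + 2 * \<delta> \<and> len t \<le> k * (len s1 + len s2 + len s3))"
  using \<open>a \<in> carrier G\<close>
proof (induction k arbitrary: a)
  case 0
  have "0 \<le> C"
    using dirs gp_nonneg[of s1 s2] unfolding three_directions_def by linarith
  moreover have "gp a \<one> = 0" using 0 by (simp add: gp_def)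
  ultimately show ?case
    using delta_nonneg by (intro exI[of _ "{\<one>}"]) auto
next
  case (Suc k)
  let ?L = "len s1 + len s2 + len s3"
  obtain s s' where s: "s \<in> {s1, s2, s3}" "s' \<in> {s1, s2, s3}" "gp s s' \<le> C"
    "gp a s \<le> C + \<delta>" "gp a s' \<le> C + \<delta>"
    using dirs Suc.prems by (rule two_good_directions)
  have branch: "\<exists>W \<subseteq> carrier G. finite W \<and> 2 ^ k \<le> card W \<and>
      (\<forall>t\<in>W. gp a t \<le> C + 2 * \<delta> \<and> len t \<le> Suc k * ?L \<and> C + 2 * \<delta> < gp r t)"
    if r: "r \<in> {s1, s2, s3}" "gp a r \<le> C + \<delta>" for r
  proof -
    have rc: "r \<in> carrier G" "2 * C + 5 * \<delta> < len r" "len r \<le> ?L"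
      using r dirs by (auto simp: three_directions_def)
    obtain W where W: "W \<subseteq> carrier G" "finite W" "2 ^ k \<le> card W"
      and out: "\<And>t. t \<in> W \<Longrightarrow> gp (inv r \<otimes> a) t \<le> C + 2 * \<delta> \<and> len t \<le> k * ?L"
      using Suc.IH[of "inv r \<otimes> a"] rc Suc.prems by auto
    have "gp a (r \<otimes> t) \<le> C + 2 * \<delta> \<and> len (r \<otimes> t) \<le> Suc k * ?L \<and> C + 2 * \<delta> < gp r (r \<otimes> t)"
      if t: "t \<in> W" for t
    proof (intro conjI)
      have tc: "t \<in> carrier G" using t W by auto
      have "gp (inv r \<otimes> a) (inv r) = len r - gp a r"
        using gp_shift[of r a] rc Suc.prems by simp
      then have "gp (inv r) t \<le> C + 2 * \<delta> + \<delta>"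
        by (intro gp_le_of_left[of "inv r \<otimes> a"]) (use rc Suc.prems tc r out[OF t] delta_nonneg in auto)
      then have near: "len r - C - 3 * \<delta> \<le> gp r (r \<otimes> t)"
        using gp_mult[of r t] gp_commute[of t "inv r"] gp_commute[of "r \<otimes> t" r] rc tc by simp
      then show "C + 2 * \<delta> < gp r (r \<otimes> t)" using rc by linarith
      have "gp a (r \<otimes> t) \<le> C + \<delta> + \<delta>"
        by (rule gp_le_of_right[of _ _ r])
          (use near rc tc Suc.prems r gp_commute[of "r \<otimes> t" r] in auto)
      then show "gp a (r \<otimes> t) \<le> C + 2 * \<delta>" by simp
      show "len (r \<otimes> t) \<le> Suc k * ?L"
        using len_mult[of r t] rc tc out[OF t] by simp
    qed
    moreover have "card ((\<otimes>) r ` W) = card W"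
      using W(1) rc(1) by (intro card_image inj_onI) (auto simp: subset_iff)
    ultimately show ?thesis
      using W rc by (intro exI[of _ "(\<otimes>) r ` W"]) auto
  qed
  obtain W where W: "W \<subseteq> carrier G" "finite W" "2 ^ k \<le> card W"
    "\<forall>t\<in>W. gp a t \<le> C + 2 * \<delta> \<and> len t \<le> Suc k * ?L \<and> C + 2 * \<delta> < gp s t"
    using branch[OF s(1,4)] by blast
  obtain W' where W': "W' \<subseteq> carrier G" "finite W'" "2 ^ k \<le> card W'"
    "\<forall>t\<in>W'. gp a t \<le> C + 2 * \<delta> \<and> len t \<le> Suc k * ?L \<and> C + 2 * \<delta> < gp s' t"
    using branch[OF s(2,5)] by blast
  have sc: "s \<in> carrier G" "s' \<in> carrier G"
    using s dirs by (auto simp: three_directions_def)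
  have "W \<inter> W' = {}"
  proof (rule ccontr)
    assume "W \<inter> W' \<noteq> {}"
    then obtain t where t: "t \<in> W" "t \<in> W'" by blast
    then have "t \<in> carrier G" using W by auto
    then show False
      using four_point[of s t s'] bspec[OF W(4) t(1)] bspec[OF W'(4) t(2)] sc s(3)
        gp_commute[of s' t] delta_nonneg by linarith
  qed
  then have "2 ^ Suc k \<le> card (W \<union> W')"
    using W W' by (simp add: card_Un_disjoint)
  then show ?case
    using W W' by (intro exI[of _ "W \<union> W'"]) auto
qed

text \<open>Conversely the element \<open>inv b\<close> is reached by few displacements \<open>t\<close>: the starting point
  \<open>inv b \<otimes> inv t\<close> lies near a geodesic from \<open>inv b\<close> to the identity, and on a geodesic it is determined,
  up to a bounded error, by its distance \<open>len t\<close> from the end.\<close>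

lemma card_displacements_le:
  fixes C :: real
  assumes b: "b \<in> carrier G"
  shows "card {t \<in> ball n. len t - C \<le> gp b (inv t)} \<le> (n + 1) * card (ball (nat \<lfloor>2 * C + 2 * \<delta>\<rfloor>))"
proof -
  define I where "I r = {t \<in> carrier G. len t = r \<and> len t - C \<le> gp b (inv t)}" for r
  let ?B = "ball (nat \<lfloor>2 * C + 2 * \<delta>\<rfloor>)"
  have fin: "finite (I r)" for r
    by (rule finite_subset[OF _ finite_ball[of r]]) (auto simp: I_def ball_def)
  have "card (I r) \<le> card ?B" for r
  proof (cases "I r = {}")
    case False
    then obtain t0 where t0: "t0 \<in> I r" by blast
    have "I r \<subseteq> (\<lambda>u. u \<otimes> t0) ` ?B"
    proof
      fix t assume t: "t \<in> I r"
      have c: "t \<in> carrier G" "t0 \<in> carrier G" using t t0 by (auto simp: I_def)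
      have "r - C - \<delta> \<le> gp (inv t) (inv t0)"
        using four_point[of "inv t" b "inv t0"] c b t t0 gp_commute[of b "inv t"]
        by (auto simp: I_def)
      then have "len (t \<otimes> inv t0) \<le> 2 * C + 2 * \<delta>"
        using c t t0 by (simp add: gp_def I_def)
      then have "t \<otimes> inv t0 \<in> ?B"
        using c unfolding ball_def by (simp add: le_nat_iff le_floor_iff)
      moreover have "t = (t \<otimes> inv t0) \<otimes> t0" using c by (simp add: m_assoc)
      ultimately show "t \<in> (\<lambda>u. u \<otimes> t0) ` ?B" by blast
    qed
    then show ?thesis by (intro surj_card_le) auto
  qed simp
  then have "card (\<Union>r\<le>n. I r) \<le> (\<Sum>r\<le>n. card ?B)"
    by (intro order_trans[OF card_UN_le] sum_mono) auto
  moreover have "{t \<in> ball n. len t - C \<le> gp b (inv t)} = (\<Union>r\<le>n. I r)"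
    by (auto simp: I_def ball_def)
  ultimately show ?thesis by simp
qed

text \<open>Non-amenability in the form of Reiter: no summable function is almost invariant
  under a suitable finite set of translations.  Compare, for a nonnegative function, the sum of its
  values at the continuations of all points with the sum of its own values.\<close>

lemma not_right_amenable:
  assumes "\<not> elementary_group G"
  shows "\<exists>T \<subseteq> carrier G. finite T \<and> (\<forall>F. (\<forall>x. 0 \<le> F x) \<longrightarrow> mass F < \<infinity> \<longrightarrow>
    mass F \<le> (\<Sum>t\<in>T. mass (\<lambda>x. \<bar>F (x \<otimes> t) - F x\<bar>)))"
proof -
  obtain C s1 s2 s3 where dirs: "three_directions C s1 s2 s3"
    using exists_three_directions[OF assms] by blast
  let ?C = "C + 2 * \<delta>" and ?L = "len s1 + len s2 + len s3"
  let ?B = "card (ball (nat \<lfloor>2 * ?C + 2 * \<delta>\<rfloor>))"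
  obtain k :: nat where k: "(k * ?L + 1) * ?B < 2 ^ k" using linear_less_power2 by blast
  define V where "V = (k * ?L + 1) * ?B"
  define T where "T = ball (k * ?L)"
  have T: "T \<subseteq> carrier G" "finite T" using ball_carrier by (auto simp: T_def)
  have "\<forall>a\<in>carrier G. \<exists>W. W \<subseteq> T \<and> V + 1 \<le> card W \<and> (\<forall>t\<in>W. gp a t \<le> ?C)"
  proof
    fix a assume a: "a \<in> carrier G"
    obtain W where "W \<subseteq> carrier G" "2 ^ k \<le> card W" "\<forall>t\<in>W. gp a t \<le> ?C \<and> len t \<le> k * ?L"
      using many_continuations[OF dirs a, of k] by blast
    moreover from this have "W \<subseteq> T" unfolding T_def ball_def by blast
    moreover have "V + 1 \<le> card W" using \<open>2 ^ k \<le> card W\<close> k unfolding V_def by linarith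
    ultimately show "\<exists>W. W \<subseteq> T \<and> V + 1 \<le> card W \<and> (\<forall>t\<in>W. gp a t \<le> ?C)" by blast
  qed
  from bchoice[OF this] obtain W where
    "\<forall>a\<in>carrier G. W a \<subseteq> T \<and> V + 1 \<le> card (W a) \<and> (\<forall>t\<in>W a. gp a t \<le> ?C)" ..
  then have W: "\<And>a. a \<in> carrier G \<Longrightarrow> W a \<subseteq> T" "\<And>a. a \<in> carrier G \<Longrightarrow> V + 1 \<le> card (W a)"
    "\<And>a t. a \<in> carrier G \<Longrightarrow> t \<in> W a \<Longrightarrow> gp a t \<le> ?C"
    by blast+
  have "mass F \<le> (\<Sum>t\<in>T. mass (\<lambda>x. \<bar>F (x \<otimes> t) - F x\<bar>))"
    if F: "\<forall>x. 0 \<le> F x" and fin: "mass F < \<infinity>" for F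
  proof -
    let ?D = "\<lambda>t x. \<bar>F (x \<otimes> t) - F x\<bar>"
    let ?J = "\<lambda>t x. of_bool (t \<in> W (inv x)) * F (x \<otimes> t)"
    \<comment> \<open>Replace \<open>F x\<close> by \<open>F (x \<otimes> t)\<close> for each of the \<open>V + 1\<close> continuations \<open>t\<close>; in the sum over all \<open>x\<close>,
      each value of \<open>F\<close> then occurs at most \<open>V\<close> times.\<close>
    have pointwise: "real (V + 1) * F x \<le> (\<Sum>t\<in>T. ?J t x) + (\<Sum>t\<in>T. ?D t x)" if x: "x \<in> carrier G" for x
    proof -
      have sub: "W (inv x) \<subseteq> T" using W(1) x by simp
      have "real (V + 1) * F x \<le> real (card (W (inv x))) * F x"
        using W(2)[of "inv x"] x F by (intro mult_right_mono) auto
      also have "\<dots> = (\<Sum>t\<in>W (inv x). F x)" by simp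
      also have "\<dots> \<le> (\<Sum>t\<in>W (inv x). F (x \<otimes> t) + ?D t x)"
        by (intro sum_mono) linarith
      also have "\<dots> = (\<Sum>t\<in>W (inv x). ?J t x) + (\<Sum>t\<in>W (inv x). ?D t x)"
        by (simp add: sum.distrib)
      also have "\<dots> \<le> (\<Sum>t\<in>T. ?J t x) + (\<Sum>t\<in>T. ?D t x)"
        using F by (intro add_mono sum_mono2 T sub) auto
      finally show ?thesis .
    qed
    have "(\<Sum>t\<in>T. mass (?J t)) = (\<Sum>t\<in>T. mass (\<lambda>x. of_bool (t \<in> W (t \<otimes> inv x)) * F x))"
    proof (intro sum.cong refl)
      fix t assume "t \<in> T"
      then have t: "t \<in> carrier G" using T by auto
      have "mass (?J t) = mass (\<lambda>x. ?J t (x \<otimes> inv t))"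
        using t by (intro mass_rmult[symmetric]) auto
      also have "\<dots> = mass (\<lambda>x. of_bool (t \<in> W (t \<otimes> inv x)) * F x)"
        using t by (intro nn_integral_cong) (simp add: inv_mult_group m_assoc)
      finally show "mass (?J t) = mass (\<lambda>x. of_bool (t \<in> W (t \<otimes> inv x)) * F x)" .
    qed
    also have "\<dots> = mass (\<lambda>x. (\<Sum>t\<in>T. of_bool (t \<in> W (t \<otimes> inv x)) * F x))"
      using F by (intro mass_sum[symmetric]) auto
    also have "\<dots> \<le> mass (\<lambda>x. real V * F x)"
    proof (rule mass_mono)
      fix x assume x: "x \<in> carrier G"
      have "{t \<in> T. t \<in> W (t \<otimes> inv x)} \<subseteq> {t \<in> ball (k * ?L). len t - ?C \<le> gp (inv x) (inv t)}"
      proof clarify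
        fix t assume t: "t \<in> T" "t \<in> W (t \<otimes> inv x)"
        then have tc: "t \<in> carrier G" using T by auto
        have "gp (t \<otimes> inv x) t \<le> ?C" using W(3)[OF _ t(2)] tc x by simp
        then show "t \<in> ball (k * ?L) \<and> len t - ?C \<le> gp (inv x) (inv t)"
          using gp_shift[of "inv t" "inv x"] tc x t by (simp add: T_def)
      qed
      then have "card {t \<in> T. t \<in> W (t \<otimes> inv x)}
          \<le> card {t \<in> ball (k * ?L). len t - ?C \<le> gp (inv x) (inv t)}"
        by (rule card_mono[rotated]) simp
      also have "\<dots> \<le> V"
        unfolding V_def using x by (intro card_displacements_le) simp
      finally have "card {t \<in> T. t \<in> W (t \<otimes> inv x)} \<le> V" .
      then have "(\<Sum>t\<in>T. of_bool (t \<in> W (t \<otimes> inv x)) :: real) \<le> V"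
        using T(2) by (simp add: Collect_conj_eq Int_commute)
      then show "(\<Sum>t\<in>T. of_bool (t \<in> W (t \<otimes> inv x)) * F x) \<le> real V * F x"
        using F by (simp add: sum_distrib_right[symmetric] mult_right_mono)
    qed
    also have "\<dots> = V * mass F" by (simp add: mass_cmult ennreal_of_nat_eq_real_of_nat)
    finally have J: "(\<Sum>t\<in>T. mass (?J t)) \<le> V * mass F" .
    have "mass (\<lambda>x. real (V + 1) * F x) \<le> mass (\<lambda>x. (\<Sum>t\<in>T. ?J t x) + (\<Sum>t\<in>T. ?D t x))"
      by (rule mass_mono[OF pointwise])
    also have "\<dots> = (\<Sum>t\<in>T. mass (?J t)) + (\<Sum>t\<in>T. mass (?D t))"
      using F by (subst mass_add) (auto intro!: sum_nonneg simp: mass_sum)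
    also have "\<dots> \<le> V * mass F + (\<Sum>t\<in>T. mass (?D t))"
      using J by (rule add_right_mono)
    finally have "V * mass F + mass F \<le> V * mass F + (\<Sum>t\<in>T. mass (?D t))"
      by (subst (asm) mass_cmult) (simp_all add: distrib_right ennreal_of_nat_eq_real_of_nat add.commute)
    moreover have "V * mass F < \<infinity>"
      using fin by (simp add: ennreal_mult_less_top ennreal_of_nat_eq_real_of_nat)
    ultimately show ?thesis by (auto simp: ennreal_add_left_cancel_le)
  qed
  then show ?thesis using T by blast
qed

text \<open>It suffices to test translations by a set that generates the group as a semigroup, since
  translation by a product moves a function by at most the sum of what the factors do.\<close>

lemma nonamenable:
  assumes "\<not> elementary_group G"
    and A: "finite A" "A \<subseteq> carrier G" "carrier G \<subseteq> {list_prod G w | w. set w \<subseteq> A}"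
  shows "\<exists>M::nat. \<forall>F. (\<forall>x. 0 \<le> F x) \<longrightarrow> mass F < \<infinity> \<longrightarrow>
    mass F \<le> of_nat M * (\<Sum>g\<in>A. mass (\<lambda>x. \<bar>F (x \<otimes> g) - F x\<bar>))"
proof -
  obtain T where T: "T \<subseteq> carrier G" "finite T"
    and reiter: "\<And>F. (\<forall>x. 0 \<le> F x) \<Longrightarrow> mass F < \<infinity> \<Longrightarrow>
      mass F \<le> (\<Sum>t\<in>T. mass (\<lambda>x. \<bar>F (x \<otimes> t) - F x\<bar>))"
    using not_right_amenable[OF assms(1)] by blast
  have "\<forall>t\<in>T. \<exists>w. set w \<subseteq> A \<and> list_prod G w = t"
  proof
    fix t assume "t \<in> T"
    then have "t \<in> {list_prod G w | w. set w \<subseteq> A}" using T(1) A(3) by blast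
    then show "\<exists>w. set w \<subseteq> A \<and> list_prod G w = t" by (elim CollectE exE conjE) metis
  qed
  from bchoice[OF this] obtain w where
    w: "\<And>t. t \<in> T \<Longrightarrow> set (w t) \<subseteq> A \<and> list_prod G (w t) = t" by blast
  define M where "M = (\<Sum>t\<in>T. length (w t))"
  have "mass F \<le> of_nat M * (\<Sum>g\<in>A. mass (\<lambda>x. \<bar>F (x \<otimes> g) - F x\<bar>))"
    if F: "\<forall>x. 0 \<le> F x" "mass F < \<infinity>" for F
  proof -
    let ?D = "\<lambda>g. mass (\<lambda>x. \<bar>F (x \<otimes> g) - F x\<bar>)"
    have word: "?D (list_prod G v) \<le> of_nat (length v) * (\<Sum>g\<in>A. ?D g)" if "set v \<subseteq> A" for v
      using that
    proof (induction v)
      case Nil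
      have "?D \<one> = mass (\<lambda>x. 0)" by (intro nn_integral_cong) simp
      then show ?case by simp
    next
      case (Cons g v)
      have c: "g \<in> carrier G" "set v \<subseteq> carrier G" using Cons.prems A by auto
      let ?h = "list_prod G v"
      have h: "?h \<in> carrier G" using c by (intro list_prod_closed)
      have "?D (g \<otimes> ?h) \<le> mass (\<lambda>x. \<bar>F (x \<otimes> g \<otimes> ?h) - F (x \<otimes> g)\<bar> + \<bar>F (x \<otimes> g) - F x\<bar>)"
        using c h by (intro mass_mono) (simp add: m_assoc)
      also have "\<dots> = mass (\<lambda>x. \<bar>F (x \<otimes> g \<otimes> ?h) - F (x \<otimes> g)\<bar>) + ?D g"
        by (intro mass_add) auto
      also have "\<dots> = ?D ?h + ?D g"
        using mass_rmult[of g "\<lambda>x. ennreal \<bar>F (x \<otimes> ?h) - F x\<bar>"] c by simp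
      also have "\<dots> \<le> of_nat (length v) * (\<Sum>g\<in>A. ?D g) + (\<Sum>g\<in>A. ?D g)"
        using Cons A(1) by (intro add_mono member_le_sum) auto
      also have "\<dots> = of_nat (length (g # v)) * (\<Sum>g\<in>A. ?D g)"
        by (simp add: distrib_right add.commute)
      finally show ?case by simp
    qed
    have "mass F \<le> (\<Sum>t\<in>T. ?D t)" using F by (rule reiter)
    also have "\<dots> \<le> (\<Sum>t\<in>T. of_nat (length (w t)) * (\<Sum>g\<in>A. ?D g))"
    proof (rule sum_mono)
      fix t assume "t \<in> T"
      then show "?D t \<le> of_nat (length (w t)) * (\<Sum>g\<in>A. ?D g)"
        using word[of "w t"] w[of t] by simp
    qed
    also have "\<dots> = of_nat M * (\<Sum>g\<in>A. ?D g)"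
      by (simp add: M_def sum_distrib_right)
    finally show ?thesis .
  qed
  then show ?thesis by blast
qed

end

section \<open>Convolution powers\<close>

locale group_walk = group G for G (structure) +
  fixes \<mu> :: "'a pmf"
  assumes support_carrier: "set_pmf \<mu> \<subseteq> carrier G"
    and finite_support: "finite (set_pmf \<mu>)"
begin

abbreviation law :: "nat \<Rightarrow> 'a pmf" where
  "law n \<equiv> conv_power G \<mu> n"

lemma set_law_carrier: "set_pmf (law n) \<subseteq> carrier G"
  using support_carrier by (induction n) auto

lemma law_carrier: "x \<in> set_pmf (law n) \<Longrightarrow> x \<in> carrier G"
  using set_law_carrier by blast

lemma finite_set_law [simp]: "finite (set_pmf (law n))"
  using finite_support by (induction n) auto

lemma integrable_law [simp]: "integrable (measure_pmf (law n)) (f :: 'a \<Rightarrow> real)"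
  by (intro integrable_measure_pmf_finite finite_set_law)

lemma law_add: "law (m + n) = map_pmf (\<lambda>(x, y). x \<otimes> y) (pair_pmf (law m) (law n))"
proof (induction n)
  case 0
  have "map_pmf (\<lambda>(x, y). x \<otimes> y) (pair_pmf (law m) (law 0)) = map_pmf (\<lambda>x. x \<otimes> \<one>) (law m)"
    by (simp add: pair_return_pmf2 map_pmf_comp)
  also have "\<dots> = map_pmf id (law m)"
    by (intro map_pmf_cong) (auto dest: law_carrier)
  finally show ?case by simp
next
  case (Suc n)
  have "law (m + Suc n) = bind_pmf (law m) (\<lambda>x. bind_pmf (law n) (\<lambda>y. bind_pmf \<mu> (\<lambda>z. return_pmf (x \<otimes> y \<otimes> z))))"
    using Suc by (simp add: pair_pmf_def map_pmf_def bind_assoc_pmf bind_return_pmf)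
  also have "\<dots> = bind_pmf (law m) (\<lambda>x. bind_pmf (law n) (\<lambda>y. bind_pmf \<mu> (\<lambda>z. return_pmf (x \<otimes> (y \<otimes> z)))))"
    using support_carrier
    by (intro bind_pmf_cong refl arg_cong[where f = return_pmf] m_assoc) (auto dest: law_carrier)
  also have "\<dots> = map_pmf (\<lambda>(x, y). x \<otimes> y) (pair_pmf (law m) (law (Suc n)))"
    by (simp add: pair_pmf_def map_pmf_def bind_assoc_pmf bind_return_pmf)
  finally show ?case .
qed

lemma pmf_law_mult_ge: "pmf (law m) x * pmf (law n) y \<le> pmf (law (m + n)) (x \<otimes> y)"
proof -
  have "pmf (law m) x * pmf (law n) y = measure (pair_pmf (law m) (law n)) {(x, y)}"
    by (simp add: pmf_pair[symmetric] measure_pmf_single)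
  also have "\<dots> \<le> measure (pair_pmf (law m) (law n)) ((\<lambda>(x, y). x \<otimes> y) -` {x \<otimes> y})"
    by (intro measure_pmf.finite_measure_mono) auto
  also have "\<dots> = pmf (law (m + n)) (x \<otimes> y)"
    by (simp add: law_add pmf_map)
  finally show ?thesis .
qed

lemma pmf_law_Suc:
  assumes "x \<in> carrier G"
  shows "pmf (law (Suc n)) x = (\<Sum>g\<in>set_pmf \<mu>. pmf \<mu> g * pmf (law n) (x \<otimes> inv g))"
proof -
  have "law (Suc n) = bind_pmf \<mu> (\<lambda>g. map_pmf (\<lambda>y. y \<otimes> g) (law n))"
    unfolding conv_power.simps pair_pmf_def map_bind_pmf bind_return_pmf
    by (subst bind_commute_pmf) (simp add: map_pmf_def bind_assoc_pmf bind_return_pmf)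
  then have "pmf (law (Suc n)) x = (\<integral>g. pmf (map_pmf (\<lambda>y. y \<otimes> g) (law n)) x \<partial>measure_pmf \<mu>)"
    by (simp add: pmf_bind)
  also have "\<dots> = (\<Sum>g\<in>set_pmf \<mu>. pmf (map_pmf (\<lambda>y. y \<otimes> g) (law n)) x * pmf \<mu> g)"
    by (intro integral_measure_pmf_real finite_support) auto
  also have "\<dots> = (\<Sum>g\<in>set_pmf \<mu>. pmf \<mu> g * pmf (law n) (x \<otimes> inv g))"
  proof (intro sum.cong refl)
    fix g assume "g \<in> set_pmf \<mu>"
    then have g: "g \<in> carrier G" using support_carrier by auto
    have "measure (law n) ((\<lambda>y. y \<otimes> g) -` {x}) = measure (law n) {x \<otimes> inv g}"
    proof (rule measure_pmf.finite_measure_eq_AE)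
      have "y \<otimes> g = x \<longleftrightarrow> y = x \<otimes> inv g" if "y \<in> carrier G" for y
        using that g assms by (metis inv_solve_right' m_closed inv_closed)
      then show "AE y in law n. y \<in> (\<lambda>y. y \<otimes> g) -` {x} \<longleftrightarrow> y \<in> {x \<otimes> inv g}"
        using set_law_carrier by (auto simp: AE_measure_pmf_iff)
    qed auto
    then show "pmf (map_pmf (\<lambda>y. y \<otimes> g) (law n)) x * pmf \<mu> g = pmf \<mu> g * pmf (law n) (x \<otimes> inv g)"
      by (simp add: pmf_map measure_pmf_single)
  qed
  finally show ?thesis .
qed

declare conv_power.simps(2) [simp del]

text \<open>The squared norm of the law in the space of square summable functions, a finite sum because
  the law has finite support.\<close>

definition energy :: "nat \<Rightarrow> real" where
  "energy n = (\<Sum>x\<in>set_pmf (law n). (pmf (law n) x)\<^sup>2)"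

lemma energy_nonneg: "0 \<le> energy n"
  by (simp add: energy_def sum_nonneg)

lemma mass_energy: "mass (\<lambda>x. (pmf (law n) x)\<^sup>2) = ennreal (energy n)"
proof -
  have "mass (\<lambda>x. (pmf (law n) x)\<^sup>2) = (\<Sum>x\<in>set_pmf (law n). ennreal ((pmf (law n) x)\<^sup>2))"
    using set_law_carrier
    by (intro nn_integral_count_space') (auto simp: set_pmf_iff)
  also have "\<dots> = ennreal (energy n)"
    unfolding energy_def by (intro sum_ennreal) auto
  finally show ?thesis .
qed

lemma pmf_le_sqrt_energy: "pmf (law n) x \<le> sqrt (energy n)"
proof (cases "x \<in> set_pmf (law n)")
  case True
  then have "(pmf (law n) x)\<^sup>2 \<le> energy n"
    unfolding energy_def by (intro member_le_sum) auto
  then show ?thesis by (rule real_le_rsqrt)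
next
  case False
  then show ?thesis by (simp add: set_pmf_iff energy_nonneg)
qed

text \<open>Convolution is an average of translations, which are isometries.  The variance of this
  average is the loss of energy.\<close>

lemma energy_loss:
  "(\<Sum>g\<in>set_pmf \<mu>. ennreal (pmf \<mu> g) *
      mass (\<lambda>x. (pmf (law n) (x \<otimes> inv g) - pmf (law (Suc n)) x)\<^sup>2)) + energy (Suc n) = energy n"
proof -
  let ?f = "pmf (law n)" and ?h = "pmf (law (Suc n))" and ?A = "set_pmf \<mu>"
  have one: "(\<Sum>g\<in>?A. pmf \<mu> g) = 1"
    by (intro sum_pmf_eq_1 finite_support) auto
  have var: "(\<Sum>g\<in>?A. pmf \<mu> g * (?f (x \<otimes> inv g) - ?h x)\<^sup>2) + (?h x)\<^sup>2 = (\<Sum>g\<in>?A. pmf \<mu> g * (?f (x \<otimes> inv g))\<^sup>2)"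
    if x: "x \<in> carrier G" for x
  proof -
    have "(\<Sum>g\<in>?A. pmf \<mu> g * (?f (x \<otimes> inv g) - ?h x)\<^sup>2) =
        (\<Sum>g\<in>?A. pmf \<mu> g * (?f (x \<otimes> inv g))\<^sup>2 - 2 * ?h x * (pmf \<mu> g * ?f (x \<otimes> inv g)) + pmf \<mu> g * (?h x)\<^sup>2)"
      by (intro sum.cong refl) (simp add: power2_eq_square algebra_simps)
    also have "\<dots> = (\<Sum>g\<in>?A. pmf \<mu> g * (?f (x \<otimes> inv g))\<^sup>2)
        - 2 * ?h x * (\<Sum>g\<in>?A. pmf \<mu> g * ?f (x \<otimes> inv g)) + (\<Sum>g\<in>?A. pmf \<mu> g) * (?h x)\<^sup>2"
      by (simp only: sum.distrib sum_subtractf sum_distrib_left sum_distrib_right)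
    also have "\<dots> = (\<Sum>g\<in>?A. pmf \<mu> g * (?f (x \<otimes> inv g))\<^sup>2) - (?h x)\<^sup>2"
      using pmf_law_Suc[OF x, of n] one by (simp add: power2_eq_square)
    finally show ?thesis by simp
  qed
  have "(\<Sum>g\<in>?A. ennreal (pmf \<mu> g) * mass (\<lambda>x. (?f (x \<otimes> inv g) - ?h x)\<^sup>2)) + energy (Suc n)
      = mass (\<lambda>x. (\<Sum>g\<in>?A. pmf \<mu> g * (?f (x \<otimes> inv g) - ?h x)\<^sup>2) + (?h x)\<^sup>2)"
  proof -
    have "mass (\<lambda>x. \<Sum>g\<in>?A. pmf \<mu> g * (?f (x \<otimes> inv g) - ?h x)\<^sup>2)
        = (\<Sum>g\<in>?A. ennreal (pmf \<mu> g) * mass (\<lambda>x. (?f (x \<otimes> inv g) - ?h x)\<^sup>2))"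
      by (subst mass_sum) (auto simp: mass_cmult)
    then show ?thesis by (subst mass_add) (auto simp: mass_energy sum_nonneg)
  qed
  also have "\<dots> = mass (\<lambda>x. \<Sum>g\<in>?A. pmf \<mu> g * (?f (x \<otimes> inv g))\<^sup>2)"
    by (intro nn_integral_cong) (simp add: var)
  also have "\<dots> = (\<Sum>g\<in>?A. ennreal (pmf \<mu> g) * mass (\<lambda>x. (?f (x \<otimes> inv g))\<^sup>2))"
    by (subst mass_sum) (auto simp: mass_cmult)
  also have "\<dots> = (\<Sum>g\<in>?A. ennreal (pmf \<mu> g) * energy n)"
  proof (intro sum.cong refl arg_cong2[where f = "(*)"])
    fix g assume "g \<in> ?A"
    then have "inv g \<in> carrier G" using support_carrier by auto
    from mass_rmult[OF this, of "\<lambda>x. ennreal ((?f x)\<^sup>2)"]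
    show "mass (\<lambda>x. (?f (x \<otimes> inv g))\<^sup>2) = energy n" by (simp add: mass_energy)
  qed
  also have "\<dots> = energy n"
    using one by (simp add: sum_distrib_right[symmetric] sum_ennreal)
  finally show ?thesis .
qed

lemma energy_antimono: "m \<le> n \<Longrightarrow> energy n \<le> energy m"
proof (rule lift_Suc_antimono_le[of energy])
  fix n
  have "ennreal (energy (Suc n)) \<le> energy n"
    unfolding energy_loss[of n, symmetric] by simp
  then show "energy (Suc n) \<le> energy n" using energy_nonneg by simp
qed

lemma energy_0: "energy 0 = 1"
  by (simp add: energy_def)

end

section \<open>Decay of the return probabilities and positive drift\<close>

text \<open>The inequality of Cauchy and Schwarz in weighted form, for use under a sum.\<close>

lemma abs_diff_squares_le:
  fixes a b \<eta> :: real
  assumes "0 < \<eta>"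
  shows "\<bar>a\<^sup>2 - b\<^sup>2\<bar> \<le> 1 / (2 * \<eta>) * (a - b)\<^sup>2 + \<eta> * (a\<^sup>2 + b\<^sup>2)"
proof -
  have "0 \<le> (\<bar>a - b\<bar> - \<eta> * \<bar>a + b\<bar>)\<^sup>2" by simp
  then have "2 * \<eta> * (\<bar>a - b\<bar> * \<bar>a + b\<bar>) \<le> (a - b)\<^sup>2 + \<eta>\<^sup>2 * (a + b)\<^sup>2"
    by (simp add: power2_diff power_mult_distrib algebra_simps)
  also have "\<dots> \<le> (a - b)\<^sup>2 + \<eta>\<^sup>2 * (2 * (a\<^sup>2 + b\<^sup>2))"
    using zero_le_power2[of "a - b"]
    by (intro add_left_mono mult_left_mono) (simp_all add: power2_sum power2_diff)
  finally have "2 * \<eta> * \<bar>a\<^sup>2 - b\<^sup>2\<bar> \<le> (a - b)\<^sup>2 + 2 * \<eta>\<^sup>2 * (a\<^sup>2 + b\<^sup>2)"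
    by (simp add: abs_mult[symmetric] power2_eq_square algebra_simps)
  then show ?thesis
    using assms by (simp add: field_simps power2_eq_square)
qed

context group_walk
begin

text \<open>A small loss of energy means that the next law is close to each single translate of the law, not
  only to their average.\<close>

lemma translation_loss:
  assumes g: "g \<in> set_pmf \<mu>"
  shows "mass (\<lambda>x. (pmf (law n) (x \<otimes> inv g) - pmf (law (Suc n)) x)\<^sup>2)
    \<le> ennreal ((energy n - energy (Suc n)) / pmf \<mu> g)" (is "?d \<le> _")
proof -
  have pos: "0 < pmf \<mu> g" using g by (simp add: pmf_positive)
  have "ennreal (pmf \<mu> g) * ?d + energy (Suc n) \<le> energy n"
    unfolding energy_loss[of n, symmetric]
    using g finite_support by (intro add_right_mono member_le_sum) auto
  moreover have "?d \<noteq> \<top>"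
  proof
    assume "?d = \<top>"
    then have "ennreal (pmf \<mu> g) * ?d = \<top>"
      using pos by (simp add: ennreal_mult_top)
    with calculation show False by (simp add: top_unique)
  qed
  then obtain D where D: "?d = ennreal D" "0 \<le> D" by (cases ?d) auto
  ultimately have "ennreal (pmf \<mu> g * D + energy (Suc n)) \<le> ennreal (energy n)"
    using energy_nonneg by (simp add: ennreal_mult ennreal_plus)
  then have "pmf \<mu> g * D + energy (Suc n) \<le> energy n"
    using energy_nonneg by (simp del: ennreal_plus)
  then show ?thesis
    unfolding D(1) using pos D(2) by (intro ennreal_leI) (simp add: field_simps)
qed

lemma energy_add_le: "ennreal (energy (m + k)) + ennreal (energy (m + j)) \<le> ennreal (2 * energy m)"
proof -
  have "energy (m + k) + energy (m + j) \<le> 2 * energy m"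
    using energy_antimono[of m "m + k"] energy_antimono[of m "m + j"] by simp
  then show ?thesis
    using energy_nonneg by (simp add: ennreal_plus[symmetric] ennreal_leI del: ennreal_plus)
qed

text \<open>If the energy hardly decreased from time \<open>m\<close> to time \<open>m + L\<close>, then translating the law at
  each of these times would nearly give the next law, so that the sum of the squared laws over this
  window would be almost invariant under all translations.\<close>

lemma window_translation:
  fixes \<eta> p :: real and m L :: nat
  assumes g: "g \<in> set_pmf \<mu>" and \<eta>: "0 < \<eta>" and p: "0 < p" "p \<le> pmf \<mu> g"
  defines "F \<equiv> \<lambda>x. \<Sum>k<L. (pmf (law (m + k)) x)\<^sup>2"
  shows "mass (\<lambda>x. \<bar>F (x \<otimes> g) - F x\<bar>)
    \<le> ennreal (1 / (2 * \<eta> * p) * (energy m - energy (m + L)) + (2 * \<eta> * L + 2) * energy m)"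
proof -
  have gc: "g \<in> carrier G" using g support_carrier by auto
  let ?f = "\<lambda>k. pmf (law (m + k))"
  let ?b = "\<lambda>k x. 1 / (2 * \<eta>) * (?f k (x \<otimes> inv g) - ?f (Suc k) x)\<^sup>2
      + \<eta> * ((?f k (x \<otimes> inv g))\<^sup>2 + (?f (Suc k) x)\<^sup>2)"
  have sq: "mass (\<lambda>x. (?f k (x \<otimes> inv g))\<^sup>2) = energy (m + k)" for k
    using mass_rmult[of "inv g" "\<lambda>x. ennreal ((?f k x)\<^sup>2)"] gc by (simp add: mass_energy)
  have b: "mass (?b k) \<le> ennreal (1 / (2 * \<eta> * p) * (energy (m + k) - energy (m + Suc k)) + 2 * \<eta> * energy m)" for k
  proof -
    have "mass (\<lambda>x. (?f k (x \<otimes> inv g) - ?f (Suc k) x)\<^sup>2) \<le> ennreal ((energy (m + k) - energy (m + Suc k)) / pmf \<mu> g)"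
      using translation_loss[OF g, of "m + k"] by simp
    also have "\<dots> \<le> ennreal ((energy (m + k) - energy (m + Suc k)) / p)"
      using p energy_antimono[of "m + k" "m + Suc k"] by (intro ennreal_leI divide_left_mono) auto
    finally have "mass (\<lambda>x. 1 / (2 * \<eta>) * (?f k (x \<otimes> inv g) - ?f (Suc k) x)\<^sup>2)
        \<le> ennreal (1 / (2 * \<eta>)) * ennreal ((energy (m + k) - energy (m + Suc k)) / p)"
      using \<eta> by (subst mass_cmult) (auto intro!: mult_left_mono)
    also have "\<dots> = ennreal (1 / (2 * \<eta> * p) * (energy (m + k) - energy (m + Suc k)))"
      using \<eta> p energy_antimono[of "m + k" "m + Suc k"]
      by (subst ennreal_mult[symmetric]) auto
    finally have 1: "mass (\<lambda>x. 1 / (2 * \<eta>) * (?f k (x \<otimes> inv g) - ?f (Suc k) x)\<^sup>2) \<le> \<dots>" .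
    have "mass (\<lambda>x. \<eta> * ((?f k (x \<otimes> inv g))\<^sup>2 + (?f (Suc k) x)\<^sup>2))
        = ennreal \<eta> * mass (\<lambda>x. (?f k (x \<otimes> inv g))\<^sup>2 + (?f (Suc k) x)\<^sup>2)"
      using \<eta> by (intro mass_cmult) auto
    also have "mass (\<lambda>x. (?f k (x \<otimes> inv g))\<^sup>2 + (?f (Suc k) x)\<^sup>2) = ennreal (energy (m + k)) + energy (m + Suc k)"
      by (subst mass_add) (simp_all add: sq mass_energy)
    also have "\<dots> \<le> ennreal (2 * energy m)"
      by (rule energy_add_le)
    also have "ennreal \<eta> * ennreal (2 * energy m) = ennreal (2 * \<eta> * energy m)"
      using \<eta> energy_nonneg by (subst ennreal_mult[symmetric]) (auto simp: mult_ac)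
    finally have 2: "mass (\<lambda>x. \<eta> * ((?f k (x \<otimes> inv g))\<^sup>2 + (?f (Suc k) x)\<^sup>2)) \<le> ennreal (2 * \<eta> * energy m)"
      by (simp add: mult_left_mono)
    have "mass (?b k) = mass (\<lambda>x. 1 / (2 * \<eta>) * (?f k (x \<otimes> inv g) - ?f (Suc k) x)\<^sup>2)
        + mass (\<lambda>x. \<eta> * ((?f k (x \<otimes> inv g))\<^sup>2 + (?f (Suc k) x)\<^sup>2))"
      using \<eta> by (intro mass_add) auto
    also have "\<dots> \<le> ennreal (1 / (2 * \<eta> * p) * (energy (m + k) - energy (m + Suc k))) + ennreal (2 * \<eta> * energy m)"
      by (intro add_mono 1 2)
    also have "\<dots> = ennreal (1 / (2 * \<eta> * p) * (energy (m + k) - energy (m + Suc k)) + 2 * \<eta> * energy m)"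
      using \<eta> p energy_nonneg energy_antimono[of "m + k" "m + Suc k"]
      by (intro ennreal_plus[symmetric]) auto
    finally show ?thesis .
  qed
  have pointwise: "\<bar>F x - F (x \<otimes> inv g)\<bar> \<le> (\<Sum>k<L. ?b k x) + ((?f 0 x)\<^sup>2 + (?f L x)\<^sup>2)" for x
  proof -
    have "(\<Sum>k<L. (?f (Suc k) x)\<^sup>2 - (?f k x)\<^sup>2) = (?f L x)\<^sup>2 - (?f 0 x)\<^sup>2"
      by (rule sum_lessThan_telescope)
    then have "F x - F (x \<otimes> inv g) =
        - (\<Sum>k<L. (?f k (x \<otimes> inv g))\<^sup>2 - (?f (Suc k) x)\<^sup>2) + ((?f 0 x)\<^sup>2 - (?f L x)\<^sup>2)"
      unfolding F_def by (simp add: sum_subtractf)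
    also have "\<bar>\<dots>\<bar> \<le> (\<Sum>k<L. \<bar>(?f k (x \<otimes> inv g))\<^sup>2 - (?f (Suc k) x)\<^sup>2\<bar>) + ((?f 0 x)\<^sup>2 + (?f L x)\<^sup>2)"
      using sum_abs[of "\<lambda>k. (?f k (x \<otimes> inv g))\<^sup>2 - (?f (Suc k) x)\<^sup>2" "{..<L}"]
        zero_le_power2[of "?f 0 x"] zero_le_power2[of "?f L x"] by linarith
    also have "\<dots> \<le> (\<Sum>k<L. ?b k x) + ((?f 0 x)\<^sup>2 + (?f L x)\<^sup>2)"
      by (intro add_right_mono sum_mono abs_diff_squares_le \<eta>)
    finally show ?thesis .
  qed
  have "mass (\<lambda>x. \<bar>F (x \<otimes> g) - F x\<bar>) = mass (\<lambda>x. \<bar>F x - F (x \<otimes> inv g)\<bar>)"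
  proof -
    have "mass (\<lambda>x. \<bar>F (x \<otimes> g) - F x\<bar>) = mass (\<lambda>x. \<bar>F (x \<otimes> inv g \<otimes> g) - F (x \<otimes> inv g)\<bar>)"
      using gc by (intro mass_rmult[symmetric]) auto
    also have "\<dots> = mass (\<lambda>x. \<bar>F x - F (x \<otimes> inv g)\<bar>)"
      using gc by (intro nn_integral_cong) (simp add: m_assoc)
    finally show ?thesis .
  qed
  also have "\<dots> \<le> mass (\<lambda>x. (\<Sum>k<L. ?b k x) + ((?f 0 x)\<^sup>2 + (?f L x)\<^sup>2))"
    by (intro mass_mono pointwise)
  also have "\<dots> = mass (\<lambda>x. \<Sum>k<L. ?b k x) + mass (\<lambda>x. (?f 0 x)\<^sup>2 + (?f L x)\<^sup>2)"
    using \<eta> by (intro mass_add sum_nonneg) auto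
  also have "\<dots> = (\<Sum>k<L. mass (?b k)) + (ennreal (energy m) + energy (m + L))"
    using \<eta> by (intro arg_cong2[where f = "(+)"] mass_sum) (auto simp: mass_add mass_energy
      simp del: ennreal_plus)
  also have "\<dots> \<le> (\<Sum>k<L. ennreal (1 / (2 * \<eta> * p) * (energy (m + k) - energy (m + Suc k)) + 2 * \<eta> * energy m))
      + ennreal (2 * energy m)"
  proof (intro add_mono sum_mono b)
    show "ennreal (energy m) + energy (m + L) \<le> ennreal (2 * energy m)"
      using energy_add_le[of m 0 L] by simp
  qed
  also have "\<dots> = ennreal ((\<Sum>k<L. 1 / (2 * \<eta> * p) * (energy (m + k) - energy (m + Suc k)) + 2 * \<eta> * energy m)
      + 2 * energy m)"
  proof -
    have nn: "0 \<le> 1 / (2 * \<eta> * p) * (energy (m + k) - energy (m + Suc k)) + 2 * \<eta> * energy m" for k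
      using \<eta> p energy_nonneg energy_antimono[of "m + k" "m + Suc k"] by auto
    show ?thesis
      by (subst sum_ennreal) (use nn energy_nonneg in \<open>auto intro!: ennreal_plus[symmetric] sum_nonneg simp del: ennreal_plus\<close>)
  qed
  also have "(\<Sum>k<L. 1 / (2 * \<eta> * p) * (energy (m + k) - energy (m + Suc k)) + 2 * \<eta> * energy m)
      = 1 / (2 * \<eta> * p) * (energy m - energy (m + L)) + L * (2 * \<eta> * energy m)"
  proof -
    have "(\<Sum>k<L. energy (m + k) - energy (m + Suc k)) = energy m - energy (m + L)"
      using sum_lessThan_telescope'[of "\<lambda>k. energy (m + k)" L] by simp
    then show ?thesis
      by (simp only: sum.distrib sum_distrib_left[symmetric] sum_constant card_lessThan mult_ac)
  qed
  finally show ?thesis by (simp add: algebra_simps)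
qed

text \<open>Comparing the preceding bound with non-amenability.  With \<open>\<eta> = 1 / (8 * q)\<close> and \<open>L = 8 * q\<close> the terms
  proportional to the energy at time \<open>m\<close> amount to \<open>L / 2 * energy m\<close>, half of what the window would
  contain if no energy were lost; the other half has to come from the loss of energy.\<close>

lemma energy_contraction:
  assumes reiter: "\<And>F. (\<forall>x. 0 \<le> F x) \<Longrightarrow> mass F < \<infinity> \<Longrightarrow>
    mass F \<le> of_nat M * (\<Sum>g\<in>set_pmf \<mu>. mass (\<lambda>x. \<bar>F (x \<otimes> g) - F x\<bar>))"
  obtains L :: nat and r :: real where "0 < L" "0 < r" "r < 1" "\<And>m. energy (m + L) \<le> r * energy m"
proof -
  let ?A = "set_pmf \<mu>"
  define q where "q = M * card ?A + 1"
  define \<eta> where "\<eta> = 1 / (8 * real q)"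
  define L where "L = 8 * q"
  define p where "p = Min (pmf \<mu> ` ?A)"
  have "p \<in> pmf \<mu> ` ?A"
    unfolding p_def using finite_support by (intro Min_in) (auto simp: set_pmf_not_empty)
  then have p: "0 < p" by (auto simp: pmf_positive)
  have p_le: "p \<le> pmf \<mu> g" if "g \<in> ?A" for g
    unfolding p_def using finite_support that by (intro Min_le) auto
  have q: "1 \<le> real q" by (simp add: q_def)
  have \<eta>: "0 < \<eta>" using q by (simp add: \<eta>_def)
  define K where "K = 4 * real q ^ 2 / p"
  have K: "0 < K" using p q unfolding K_def by (intro divide_pos_pos) auto
  define r where "r = (K + L / 2) / (K + L)"
  have L: "0 < L" by (simp add: L_def q_def)
  have r: "0 < r" "r < 1" using K L by (simp_all add: r_def field_simps)
  have "energy (m + L) \<le> r * energy m" for m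
  proof -
    define F where "F = (\<lambda>x. \<Sum>k<L. (pmf (law (m + k)) x)\<^sup>2)"
    define B where "B = 1 / (2 * \<eta> * p) * (energy m - energy (m + L)) + (2 * \<eta> * L + 2) * energy m"
    have B: "0 \<le> B"
      using \<eta> p energy_nonneg energy_antimono[of m "m + L"] by (simp add: B_def)
    have massF: "mass F = ennreal (\<Sum>k<L. energy (m + k))"
      unfolding F_def by (subst mass_sum) (auto simp: mass_energy sum_ennreal energy_nonneg)
    have "real L * energy (m + L) = (\<Sum>k<L. energy (m + L))" by simp
    also have "\<dots> \<le> (\<Sum>k<L. energy (m + k))" by (intro sum_mono energy_antimono) auto
    finally have "ennreal (real L * energy (m + L)) \<le> mass F"
      unfolding massF by (rule ennreal_leI)
    also have "\<dots> \<le> of_nat M * (\<Sum>g\<in>?A. mass (\<lambda>x. \<bar>F (x \<otimes> g) - F x\<bar>))"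
      by (rule reiter) (auto simp: massF, simp add: F_def sum_nonneg)
    also have "\<dots> \<le> of_nat M * (\<Sum>g\<in>?A. ennreal B)"
      unfolding F_def B_def by (intro mult_left_mono sum_mono window_translation \<eta> p p_le) auto
    also have "\<dots> = ennreal (real (M * card ?A) * B)"
      using B by (simp add: ennreal_mult ennreal_of_nat_eq_real_of_nat mult.assoc)
    also have "\<dots> \<le> ennreal (real q * B)"
      using B by (intro ennreal_leI mult_right_mono) (auto simp: q_def)
    finally have "real L * energy (m + L) \<le> real q * B"
      using B by (simp add: ennreal_le_iff)
    also have "\<dots> = K * (energy m - energy (m + L)) + real L / 2 * energy m"
      using q p by (simp add: B_def K_def \<eta>_def L_def field_simps power2_eq_square)
    finally have "(K + L) * energy (m + L) \<le> (K + L / 2) * energy m"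
      by (simp add: algebra_simps)
    then show ?thesis
      using K L by (simp add: r_def field_simps)
  qed
  with L r show ?thesis by (rule that)
qed

end

locale word_metric_walk = word_metric + group_walk
begin

definition mean_len :: "nat \<Rightarrow> real" where
  "mean_len n = measure_pmf.expectation (law n) (\<lambda>x. real (len x))"

text \<open>The walk cannot stay in small balls, because their number of elements grows at most
  exponentially in the radius, while no element has more than an exponentially small probability.\<close>

lemma mean_len_ge:
  assumes L: "0 < L" "0 < r" "r < 1" and contraction: "\<And>m. energy (m + L) \<le> r * energy m"
  obtains t where "0 < t" "\<And>i. 0 < i \<Longrightarrow> real i / 2 \<le> mean_len (t * i)"
proof -
  have decay: "energy (L * j) \<le> r ^ j" for j
  proof (induction j)
    case (Suc j)
    have "energy (L * Suc j) \<le> r * energy (L * j)"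
      using contraction[of "L * j"] by (simp add: add.commute)
    also have "\<dots> \<le> r * r ^ j" using Suc L by (intro mult_left_mono) auto
    finally show ?case by simp
  qed (simp add: energy_0)
  define s where "s = real (card S + 1)"
  have "(\<lambda>j. s * sqrt r ^ j) \<longlonglongrightarrow> s * 0"
    using L by (intro tendsto_intros LIMSEQ_power_zero) auto
  from order_tendstoD(2)[OF this, of "1/2"]
  obtain j0 where j0: "\<And>j. j0 \<le> j \<Longrightarrow> s * sqrt r ^ j < 1 / 2"
    by (auto simp: eventually_sequentially)
  \<comment> \<open>In \<open>L * j\<close> steps the probabilities decay enough to make up for increasing the radius by one.\<close>
  define j where "j = Suc j0"
  have j: "s * sqrt r ^ j \<le> 1 / 2" "0 < j" using j0[of j] by (auto simp: j_def)
  have "real i / 2 \<le> mean_len (L * j * i)" if i: "0 < i" for i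
  proof -
    let ?p = "law (L * j * i)"
    have "energy (L * j * i) \<le> r ^ (j * i)" using decay[of "j * i"] by (simp add: mult.assoc)
    then have small: "pmf ?p x \<le> sqrt r ^ (j * i)" for x
      using pmf_le_sqrt_energy[of "L * j * i" x] L
      by (smt (verit) real_sqrt_le_mono real_sqrt_power)
    have "measure ?p (ball i) = (\<Sum>x\<in>ball i. pmf ?p x)"
      by (simp add: measure_measure_pmf_finite)
    also have "\<dots> \<le> (\<Sum>x\<in>ball i. sqrt r ^ (j * i))"
      by (intro sum_mono small)
    also have "\<dots> = real (card (ball i)) * sqrt r ^ (j * i)"
      by simp
    also have "\<dots> \<le> s ^ i * sqrt r ^ (j * i)"
    proof -
      have "real (card (ball i)) \<le> real ((card S + 1) ^ i)"
        using card_ball_le[of i] unfolding of_nat_le_iff .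
      then show ?thesis
        using L by (intro mult_right_mono) (simp_all add: s_def)
    qed
    also have "\<dots> = (s * sqrt r ^ j) ^ i"
      by (simp add: power_mult power_mult_distrib)
    also have "\<dots> \<le> (1 / 2) ^ i"
      using j L by (intro power_mono) (auto simp: s_def)
    also have "\<dots> \<le> (1 / 2) ^ 1" using i by (intro power_decreasing) auto
    finally have half: "measure ?p (- ball i) \<ge> 1 / 2"
      using measure_pmf.prob_compl[of "ball i" ?p] by (simp add: Compl_eq_Diff_UNIV)
    have "real i * (1 / 2) \<le> real i * measure ?p (- ball i)"
      using half by (intro mult_left_mono) auto
    also have "\<dots> = measure_pmf.expectation ?p (\<lambda>x. real i * indicator (- ball i) x)"
      by simp
    also have "\<dots> \<le> mean_len (L * j * i)"
      unfolding mean_len_def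
      by (intro integral_mono_AE integrable_law)
        (auto simp: AE_measure_pmf_iff ball_def indicator_def dest: law_carrier)
    finally show ?thesis by simp
  qed
  with L j show ?thesis by (intro that[of "L * j"]) auto
qed

end

section \<open>Entropy, drift and growth\<close>

text \<open>Fekete's lemma.\<close>

lemma subadditive_limit:
  fixes a :: "nat \<Rightarrow> real"
  assumes zero: "a 0 = 0" and sub: "\<And>m n. a (m + n) \<le> a m + a n" and nonneg: "\<And>n. 0 \<le> a n"
  obtains L where "(\<lambda>n. a n / n) \<longlonglongrightarrow> L" "\<And>n. 0 < n \<Longrightarrow> L \<le> a n / n"
proof -
  define L where "L = (INF n\<in>{0<..}. a n / real n)"
  have bdd: "bdd_below ((\<lambda>n. a n / real n) ` {0<..})"
    using nonneg by (intro bdd_belowI2[of _ 0]) auto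
  have lower: "L \<le> a n / n" if "0 < n" for n
    unfolding L_def using that by (intro cINF_lower bdd) auto
  have mult: "a (q * k) \<le> q * a k" for q k
  proof (induction q)
    case 0
    show ?case by (simp add: zero)
  next
    case (Suc q)
    then show ?case using sub[of k "q * k"] by (simp add: algebra_simps)
  qed
  have "(\<lambda>n. a n / n) \<longlonglongrightarrow> L"
  proof (rule tendstoI)
    fix e :: real assume e: "0 < e"
    then have "L < L + e / 2" by simp
    then obtain k where k: "0 < k" "a k / real k < L + e / 2"
      unfolding L_def by (subst (asm) cINF_less_iff[OF _ bdd]) auto
    define C where "C = (\<Sum>r<k. a r)"
    have upper: "a n / n \<le> a k / k + C / n" if n: "0 < n" for n
    proof -
      have "a n \<le> a (n div k * k) + a (n mod k)"
        using sub[of "n div k * k" "n mod k"] by simp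
      also have "\<dots> \<le> real (n div k) * a k + C"
        unfolding C_def using k nonneg
        by (intro add_mono mult member_le_sum) auto
      also have "\<dots> \<le> (n / k) * a k + C"
        using nonneg by (intro add_right_mono mult_right_mono of_nat_div_le_of_nat)
      finally show ?thesis using n k by (simp add: field_simps)
    qed
    have "(\<lambda>n. C / real n) \<longlonglongrightarrow> 0" by (rule lim_const_over_n)
    then have "\<forall>\<^sub>F n in sequentially. C / real n < e / 2"
      using e by (intro order_tendstoD(2)) auto
    then show "\<forall>\<^sub>F n in sequentially. dist (a n / real n) L < e"
      using eventually_gt_at_top[of 0]
    proof eventually_elim
      case (elim n)
      then show ?case using upper[of n] lower[of n] k unfolding dist_real_def by linarith
    qed
  qed
  then show ?thesis using lower by (rule that)
qed

lemma expectation_pair_prod: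
  fixes f :: "'a \<Rightarrow> real" and g :: "'b \<Rightarrow> real"
  assumes "finite (set_pmf p)" "finite (set_pmf q)"
  shows "measure_pmf.expectation (pair_pmf p q) (\<lambda>(x, y). f x * g y) =
    measure_pmf.expectation p f * measure_pmf.expectation q g"
proof -
  have "measure_pmf.expectation (pair_pmf p q) (\<lambda>(x, y). f x * g y) =
      (\<Sum>z\<in>set_pmf p \<times> set_pmf q. (case z of (x, y) \<Rightarrow> f x * g y) * pmf (pair_pmf p q) z)"
    using assms by (intro integral_measure_pmf_real) auto
  also have "\<dots> = (\<Sum>x\<in>set_pmf p. \<Sum>y\<in>set_pmf q. (f x * pmf p x) * (g y * pmf q y))"
    by (subst sum.cartesian_product) (auto intro!: sum.cong simp: pmf_pair mult_ac)
  also have "\<dots> = (\<Sum>x\<in>set_pmf p. f x * pmf p x) * (\<Sum>y\<in>set_pmf q. g y * pmf q y)"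
    by (simp add: sum_product)
  also have "\<dots> = measure_pmf.expectation p f * measure_pmf.expectation q g"
    using assms by (simp add: integral_measure_pmf_real)
  finally show ?thesis .
qed

context group_walk
begin

definition ent :: "nat \<Rightarrow> real" where
  "ent n = measure_pmf.expectation (law n) (\<lambda>x. - ln (pmf (law n) x))"

lemma ent_0: "ent 0 = 0"
  by (simp add: ent_def)

lemma ent_nonneg: "0 \<le> ent n"
  unfolding ent_def
  by (intro integral_nonneg_AE) (auto simp: AE_measure_pmf_iff pmf_positive pmf_le_1)

text \<open>The product map can only merge atoms, which increases probabilities.\<close>

lemma ent_subadditive: "ent (m + n) \<le> ent m + ent n"
proof -
  let ?P = "pair_pmf (law m) (law n)"
  have int: "integrable (measure_pmf ?P) f" for f :: "'a \<times> 'a \<Rightarrow> real"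
    by (intro integrable_measure_pmf_finite) auto
  have "ent (m + n) = measure_pmf.expectation ?P (\<lambda>(x, y). - ln (pmf (law (m + n)) (x \<otimes> y)))"
    unfolding ent_def by (subst (1) law_add) (simp add: case_prod_unfold)
  also have "\<dots> \<le> measure_pmf.expectation ?P (\<lambda>(x, y). - ln (pmf (law m) x) - ln (pmf (law n) y))"
  proof (intro integral_mono_AE int)
    have "ln (pmf (law m) x) + ln (pmf (law n) y) \<le> ln (pmf (law (m + n)) (x \<otimes> y))"
      if "x \<in> set_pmf (law m)" "y \<in> set_pmf (law n)" for x y
    proof -
      have pos: "0 < pmf (law m) x" "0 < pmf (law n) y" using that by (auto simp: pmf_positive)
      then have "ln (pmf (law m) x) + ln (pmf (law n) y) = ln (pmf (law m) x * pmf (law n) y)"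
        by (simp add: ln_mult)
      also have "\<dots> \<le> ln (pmf (law (m + n)) (x \<otimes> y))"
        using pos pmf_law_mult_ge[of m x n y] by (intro ln_mono) auto
      finally show ?thesis .
    qed
    then show "AE z in ?P. (case z of (x, y) \<Rightarrow> - ln (pmf (law (m + n)) (x \<otimes> y)))
        \<le> (case z of (x, y) \<Rightarrow> - ln (pmf (law m) x) - ln (pmf (law n) y))"
      by (force simp: AE_measure_pmf_iff)
  qed
  also have "\<dots> = measure_pmf.expectation ?P (\<lambda>z. - ln (pmf (law m) (fst z)) + - ln (pmf (law n) (snd z)))"
    by (simp add: case_prod_unfold)
  also have "\<dots> = ent m + ent n"
    unfolding ent_def
    by (subst Bochner_Integration.integral_add[OF int int]) 
      (simp only: expectation_pair_pmf_fst[where f = "\<lambda>x. - ln (pmf (law m) x)"]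
        expectation_pair_pmf_snd[where f = "\<lambda>x. - ln (pmf (law n) x)"])
  finally show ?thesis .
qed

lemma ent_limit:
  shows "(\<lambda>n. ent n / n) \<longlonglongrightarrow> walk_entropy G \<mu>"
    and "0 < n \<Longrightarrow> walk_entropy G \<mu> \<le> ent n / n"
proof -
  obtain L where L: "(\<lambda>n. ent n / n) \<longlonglongrightarrow> L" "\<And>n. 0 < n \<Longrightarrow> L \<le> ent n / n"
    by (rule subadditive_limit[OF ent_0 ent_subadditive ent_nonneg]) blast
  have "- (1 / real n) * (\<Sum>\<^sub>\<infinity>x\<in>carrier G. pmf (law n) x * ln (pmf (law n) x)) = ent n / n" for n
  proof -
    have "(\<Sum>\<^sub>\<infinity>x\<in>carrier G. pmf (law n) x * ln (pmf (law n) x)) =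
        (\<Sum>\<^sub>\<infinity>x\<in>set_pmf (law n). pmf (law n) x * ln (pmf (law n) x))"
      by (rule infsum_cong_neutral) (auto simp: pmf_eq_0_set_pmf dest: law_carrier)
    also have "\<dots> = (\<Sum>x\<in>set_pmf (law n). pmf (law n) x * ln (pmf (law n) x))"
      by simp
    also have "\<dots> = - ent n"
      unfolding ent_def
      by (subst integral_measure_pmf_real[of "set_pmf (law n)"]) (auto simp: sum_negf mult.commute)
    finally show ?thesis by simp
  qed
  then have "walk_entropy G \<mu> = lim (\<lambda>n. ent n / n)" by (simp only: walk_entropy_def)
  also have "\<dots> = L" using L(1) by (rule limI)
  finally have "walk_entropy G \<mu> = L" .
  with L show "(\<lambda>n. ent n / n) \<longlonglongrightarrow> walk_entropy G \<mu>"
    and "0 < n \<Longrightarrow> walk_entropy G \<mu> \<le> ent n / n" by auto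
qed

lemma walk_entropy_nonneg: "0 \<le> walk_entropy G \<mu>"
  using ent_limit(1) by (rule LIMSEQ_le_const) (auto simp: ent_nonneg)

text \<open>An exponential moment of the information content.  It is the sum of the weights of the law raised
  to the power \<open>1 - \<theta>\<close>, and its logarithm is \<open>\<theta>\<close> times the Renyi entropy of order \<open>1 - \<theta>\<close>.  Like the
  entropy it can only decrease when the product map merges atoms, and it is multiplicative on
  independent pairs.\<close>

definition renyi :: "real \<Rightarrow> nat \<Rightarrow> real" where
  "renyi \<theta> n = measure_pmf.expectation (law n) (\<lambda>x. pmf (law n) x powr (- \<theta>))"

lemma renyi_nonneg: "0 \<le> renyi \<theta> n"
  unfolding renyi_def by (intro integral_nonneg_AE) auto

lemma renyi_submultiplicative:
  assumes "0 \<le> \<theta>"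
  shows "renyi \<theta> (m + n) \<le> renyi \<theta> m * renyi \<theta> n"
proof -
  let ?P = "pair_pmf (law m) (law n)"
  have int: "integrable (measure_pmf ?P) f" for f :: "'a \<times> 'a \<Rightarrow> real"
    by (intro integrable_measure_pmf_finite) auto
  have "renyi \<theta> (m + n) = measure_pmf.expectation ?P (\<lambda>(x, y). pmf (law (m + n)) (x \<otimes> y) powr (- \<theta>))"
    unfolding renyi_def by (subst (1) law_add) (simp add: case_prod_unfold)
  also have "\<dots> \<le> measure_pmf.expectation ?P (\<lambda>(x, y). pmf (law m) x powr (- \<theta>) * pmf (law n) y powr (- \<theta>))"
  proof (intro integral_mono_AE int)
    have "pmf (law (m + n)) (x \<otimes> y) powr (- \<theta>) \<le> pmf (law m) x powr (- \<theta>) * pmf (law n) y powr (- \<theta>)"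
      if "x \<in> set_pmf (law m)" "y \<in> set_pmf (law n)" for x y
    proof -
      have pos: "0 < pmf (law m) x" "0 < pmf (law n) y" using that by (auto simp: pmf_positive)
      then have "pmf (law (m + n)) (x \<otimes> y) powr (- \<theta>) \<le> (pmf (law m) x * pmf (law n) y) powr (- \<theta>)"
        using assms pmf_law_mult_ge[of m x n y] by (intro powr_mono2') auto
      then show ?thesis by (simp add: powr_mult)
    qed
    then show "AE z in ?P. (case z of (x, y) \<Rightarrow> pmf (law (m + n)) (x \<otimes> y) powr (- \<theta>))
        \<le> (case z of (x, y) \<Rightarrow> pmf (law m) x powr (- \<theta>) * pmf (law n) y powr (- \<theta>))"
      by (force simp: AE_measure_pmf_iff)
  qed
  also have "\<dots> = renyi \<theta> m * renyi \<theta> n"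
    unfolding renyi_def by (intro expectation_pair_prod) auto
  finally show ?thesis .
qed

lemma renyi_0: "renyi \<theta> 0 = 1"
  by (simp add: renyi_def)

lemma renyi_growth:
  assumes \<theta>: "0 \<le> \<theta>" and N: "0 < N" and c: "0 \<le> c" "renyi \<theta> N \<le> exp (N * c)"
  obtains C where "\<And>n. renyi \<theta> n \<le> C * exp (n * c)"
proof -
  define C where "C = (\<Sum>r<N. renyi \<theta> r)"
  have C: "0 \<le> C" unfolding C_def by (intro sum_nonneg renyi_nonneg)
  have mult: "renyi \<theta> (q * N) \<le> renyi \<theta> N ^ q" for q
  proof (induction q)
    case (Suc q)
    have "renyi \<theta> (Suc q * N) \<le> renyi \<theta> N * renyi \<theta> (q * N)"
      using renyi_submultiplicative[OF \<theta>, of N "q * N"] by simp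
    also have "\<dots> \<le> renyi \<theta> N * renyi \<theta> N ^ q"
      using Suc by (intro mult_left_mono renyi_nonneg)
    finally show ?case by simp
  qed (simp add: renyi_0)
  have "renyi \<theta> n \<le> C * exp (n * c)" for n
  proof -
    have "renyi \<theta> n \<le> renyi \<theta> (n div N * N) * renyi \<theta> (n mod N)"
      using renyi_submultiplicative[OF \<theta>, of "n div N * N" "n mod N"] by simp
    also have "\<dots> \<le> exp (N * c) ^ (n div N) * C"
    proof (intro mult_mono)
      show "renyi \<theta> (n div N * N) \<le> exp (N * c) ^ (n div N)"
        using c(2) by (intro order_trans[OF mult] power_mono renyi_nonneg)
      show "renyi \<theta> (n mod N) \<le> C"
        unfolding C_def using N by (intro member_le_sum renyi_nonneg) auto
    qed (auto simp: renyi_nonneg)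
    also have "exp (N * c) ^ (n div N) = exp (real (n div N * N) * c)"
      by (simp add: exp_of_nat_mult[symmetric] mult_ac)
    also have "\<dots> * C \<le> exp (n * c) * C"
      using c C by (intro mult_right_mono) (auto intro!: mult_right_mono simp: div_times_less_eq_dividend simp flip: of_nat_mult)
    finally show ?thesis by (simp add: mult.commute)
  qed
  then show ?thesis by (rule that)
qed

definition typical :: "real \<Rightarrow> nat \<Rightarrow> 'a set" where
  "typical \<epsilon> n = {x \<in> set_pmf (law n). exp (- (n * (walk_entropy G \<mu> + \<epsilon>))) \<le> pmf (law n) x}"

lemma card_typical: "card (typical \<epsilon> n) \<le> exp (n * (walk_entropy G \<mu> + \<epsilon>))"
proof -
  let ?c = "exp (- (n * (walk_entropy G \<mu> + \<epsilon>)))"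
  have fin: "finite (typical \<epsilon> n)"
    by (rule finite_subset[OF _ finite_set_law[of n]]) (auto simp: typical_def)
  have "card (typical \<epsilon> n) * ?c = (\<Sum>x\<in>typical \<epsilon> n. ?c)" by simp
  also have "\<dots> \<le> (\<Sum>x\<in>typical \<epsilon> n. pmf (law n) x)"
    by (intro sum_mono) (auto simp: typical_def)
  also have "\<dots> = measure (law n) (typical \<epsilon> n)"
    using fin by (simp add: measure_measure_pmf_finite)
  also have "\<dots> \<le> 1" by simp
  finally have "card (typical \<epsilon> n) * inverse (exp (n * (walk_entropy G \<mu> + \<epsilon>))) \<le> 1"
    unfolding exp_minus .
  then show ?thesis by (simp add: inverse_eq_divide)
qed

text \<open>A Chernoff bound.  At a time \<open>N\<close> at which the entropy is close to its limit, the exponential moment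
  is at most \<open>exp (\<theta> * N * (h + \<epsilon> / 2))\<close> for small \<open>\<theta>\<close>, since the derivative of its logarithm at
  \<open>\<theta> = 0\<close> is the entropy; submultiplicativity carries this bound over to all times.\<close>

lemma summable_not_typical:
  assumes \<epsilon>: "0 < \<epsilon>"
  shows "summable (\<lambda>n. measure (law n) (- typical \<epsilon> n))"
proof -
  let ?h = "walk_entropy G \<mu>"
  have "\<forall>\<^sub>F n in sequentially. ent n / n < ?h + \<epsilon> / 4 \<and> 0 < n"
    using \<epsilon> by (intro eventually_conj order_tendstoD(2)[OF ent_limit(1)] eventually_gt_at_top) auto
  then obtain N where N: "0 < N" "ent N / N < ?h + \<epsilon> / 4"
    using eventually_happens'[OF sequentially_bot] by blast
  define u where "u x = - ln (pmf (law N) x)" for x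
  define U where "U = 1 + (\<Sum>x\<in>set_pmf (law N). u x)"
  have u0: "0 \<le> u x" for x
    unfolding u_def using pmf_le_1[of "law N" x] pmf_nonneg[of "law N" x]
    by (cases "pmf (law N) x = 0") auto
  have u: "0 \<le> u x" "u x \<le> U" if "x \<in> set_pmf (law N)" for x
    unfolding U_def using that u0 member_le_sum[of x "set_pmf (law N)" u] by simp_all
  have U: "1 \<le> U" unfolding U_def using u0 by (simp add: sum_nonneg)
  \<comment> \<open>The first bound makes \<open>\<theta> * u x \<le> 1\<close>, as needed for expanding \<open>exp\<close> to second order; the second makes
    the quadratic term negligible.\<close>
  define \<theta> where "\<theta> = min (1 / U) (N * \<epsilon> / (4 * U\<^sup>2))"
  have \<theta>: "0 < \<theta>" "\<theta> * U \<le> 1" "\<theta> * U\<^sup>2 \<le> N * \<epsilon> / 4"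
    using U N \<epsilon> unfolding \<theta>_def by (auto simp: field_simps min_def)
  have "renyi \<theta> N \<le> measure_pmf.expectation (law N) (\<lambda>x. 1 + \<theta> * u x + \<theta>\<^sup>2 * U\<^sup>2)"
    unfolding renyi_def
  proof (intro integral_mono_AE integrable_law)
    have "pmf (law N) x powr (- \<theta>) \<le> 1 + \<theta> * u x + \<theta>\<^sup>2 * U\<^sup>2" if x: "x \<in> set_pmf (law N)" for x
    proof -
      have "\<theta> * u x \<le> \<theta> * U" using u[OF x] \<theta> by (intro mult_left_mono) auto
      with \<theta>(2) have le: "\<theta> * u x \<le> 1" by simp
      have "pmf (law N) x powr (- \<theta>) = exp (\<theta> * u x)"
        using x by (simp add: powr_def u_def set_pmf_iff)
      also have "\<dots> \<le> 1 + \<theta> * u x + (\<theta> * u x)\<^sup>2"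
        using le \<theta> u[OF x] by (intro exp_bound) auto
      also have "(\<theta> * u x)\<^sup>2 \<le> \<theta>\<^sup>2 * U\<^sup>2"
        using u[OF x] \<theta> unfolding power_mult_distrib by (intro mult_left_mono power_mono) auto
      finally show ?thesis by simp
    qed
    then show "AE x in law N. pmf (law N) x powr - \<theta> \<le> 1 + \<theta> * u x + \<theta>\<^sup>2 * U\<^sup>2"
      by (auto simp: AE_measure_pmf_iff)
  qed
  also have "\<dots> = 1 + \<theta> * (ent N + \<theta> * U\<^sup>2)"
    by (simp add: ent_def u_def[symmetric] power2_eq_square algebra_simps)
  also have "\<dots> \<le> exp (\<theta> * (ent N + \<theta> * U\<^sup>2))" by (rule exp_ge_add_one_self)
  also have "\<dots> \<le> exp (\<theta> * (N * (?h + \<epsilon> / 2)))"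
  proof -
    have "ent N \<le> N * (?h + \<epsilon> / 4)" using N by (simp add: field_simps)
    with \<theta>(3) have "ent N + \<theta> * U\<^sup>2 \<le> N * (?h + \<epsilon> / 2)" by (simp add: algebra_simps)
    then show ?thesis using \<theta> by simp
  qed
  finally have "renyi \<theta> N \<le> exp (N * (\<theta> * (?h + \<epsilon> / 2)))" by (simp add: mult_ac)
  then obtain C where C: "\<And>n. renyi \<theta> n \<le> C * exp (n * (\<theta> * (?h + \<epsilon> / 2)))"
    using renyi_growth[of \<theta> N "\<theta> * (?h + \<epsilon> / 2)"] \<theta> N \<epsilon> walk_entropy_nonneg by fastforce
  have bound: "measure (law n) (- typical \<epsilon> n) \<le> C * exp (- (\<theta> * \<epsilon> / 2)) ^ n" for n
  proof -
    let ?c = "exp (n * (?h + \<epsilon>))"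
    have "measure (law n) (- typical \<epsilon> n) = measure_pmf.expectation (law n) (indicator (- typical \<epsilon> n))"
      by simp
    also have "\<dots> \<le> measure_pmf.expectation (law n) (\<lambda>x. ?c powr (- \<theta>) * pmf (law n) x powr (- \<theta>))"
    proof (intro integral_mono_AE integrable_law)
      have "indicator (- typical \<epsilon> n) x \<le> ?c powr (- \<theta>) * pmf (law n) x powr (- \<theta>)"
        if x: "x \<in> set_pmf (law n)" for x
      proof (cases "x \<in> typical \<epsilon> n")
        case False
        have pos: "0 < pmf (law n) x" using x by (simp add: pmf_positive)
        have "pmf (law n) x < exp (- (n * (?h + \<epsilon>)))"
          using False x by (auto simp: typical_def)
        then have "?c * pmf (law n) x \<le> ?c * exp (- (n * (?h + \<epsilon>)))" by simp
        also have "\<dots> = 1" by (simp only: mult_exp_exp) simp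
        finally have "?c * pmf (law n) x \<le> 1" .
        then have "1 powr (- \<theta>) \<le> (?c * pmf (law n) x) powr (- \<theta>)"
          using pos \<theta> by (intro powr_mono2') auto
        then show ?thesis using False by (simp add: powr_mult indicator_def)
      qed simp
      then show "AE x in law n. indicator (- typical \<epsilon> n) x \<le> ?c powr (- \<theta>) * pmf (law n) x powr (- \<theta>)"
        by (auto simp: AE_measure_pmf_iff)
    qed
    also have "\<dots> = ?c powr (- \<theta>) * renyi \<theta> n" by (simp add: renyi_def)
    also have "\<dots> \<le> ?c powr (- \<theta>) * (C * exp (n * (\<theta> * (?h + \<epsilon> / 2))))"
      by (intro mult_left_mono C) auto
    also have "\<dots> = C * exp (- (\<theta> * \<epsilon> / 2)) ^ n"
      by (simp add: powr_def exp_add[symmetric] exp_of_nat_mult[symmetric] algebra_simps)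
    finally show ?thesis .
  qed
  have "summable (\<lambda>n. C * exp (- (\<theta> * \<epsilon> / 2)) ^ n)"
    using \<theta> \<epsilon> by (intro summable_mult summable_geometric) auto
  then show ?thesis
    by (rule summable_comparison_test_ev[rotated]) (auto simp: bound)
qed

end

context word_metric_walk
begin

lemma mean_len_0: "mean_len 0 = 0"
  by (simp add: mean_len_def)

lemma mean_len_nonneg: "0 \<le> mean_len n"
  unfolding mean_len_def by (intro integral_nonneg_AE) auto

lemma mean_len_subadditive: "mean_len (m + n) \<le> mean_len m + mean_len n"
proof -
  let ?P = "pair_pmf (law m) (law n)"
  have int: "integrable (measure_pmf ?P) f" for f :: "'a \<times> 'a \<Rightarrow> real"
    by (intro integrable_measure_pmf_finite) auto
  have "mean_len (m + n) = measure_pmf.expectation ?P (\<lambda>z. real (len (fst z \<otimes> snd z)))"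
    unfolding mean_len_def by (subst law_add) (simp add: case_prod_unfold)
  also have "\<dots> \<le> measure_pmf.expectation ?P (\<lambda>z. real (len (fst z)) + real (len (snd z)))"
    by (intro integral_mono_AE int)
      (auto simp: AE_measure_pmf_iff len_mult simp flip: of_nat_add dest!: law_carrier)
  also have "\<dots> = mean_len m + mean_len n"
    unfolding mean_len_def
    by (subst Bochner_Integration.integral_add[OF int int])
      (simp only: expectation_pair_pmf_fst[where f = "\<lambda>x. real (len x)"]
        expectation_pair_pmf_snd[where f = "\<lambda>x. real (len x)"])
  finally show ?thesis .
qed

lemma mean_len_limit:
  shows "(\<lambda>n. mean_len n / n) \<longlonglongrightarrow> walk_drift G S \<mu>"
    and "0 < n \<Longrightarrow> walk_drift G S \<mu> \<le> mean_len n / n"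
proof -
  obtain L where L: "(\<lambda>n. mean_len n / n) \<longlonglongrightarrow> L" "\<And>n. 0 < n \<Longrightarrow> L \<le> mean_len n / n"
    by (rule subadditive_limit[OF mean_len_0 mean_len_subadditive mean_len_nonneg]) blast
  have "(1 / real n) * (\<Sum>\<^sub>\<infinity>x\<in>carrier G. real (len x) * pmf (law n) x) = mean_len n / n" for n
  proof -
    have "(\<Sum>\<^sub>\<infinity>x\<in>carrier G. real (len x) * pmf (law n) x) =
        (\<Sum>\<^sub>\<infinity>x\<in>set_pmf (law n). real (len x) * pmf (law n) x)"
      by (rule infsum_cong_neutral) (auto simp: pmf_eq_0_set_pmf dest: law_carrier)
    also have "\<dots> = mean_len n"
      unfolding mean_len_def by (subst integral_measure_pmf_real[of "set_pmf (law n)"]) auto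
    finally show ?thesis by simp
  qed
  then have "walk_drift G S \<mu> = lim (\<lambda>n. mean_len n / n)" by (simp only: walk_drift_def)
  also have "\<dots> = L" using L(1) by (rule limI)
  finally have "walk_drift G S \<mu> = L" .
  with L show "(\<lambda>n. mean_len n / n) \<longlonglongrightarrow> walk_drift G S \<mu>"
    and "0 < n \<Longrightarrow> walk_drift G S \<mu> \<le> mean_len n / n" by auto
qed

lemma walk_drift_nonneg: "0 \<le> walk_drift G S \<mu>"
  using mean_len_limit(1) by (rule LIMSEQ_le_const) (auto simp: mean_len_nonneg)

text \<open>As the limit exists, it can be computed along the multiples of \<open>t\<close>.\<close>

lemma walk_drift_pos:
  assumes t: "0 < t" "\<And>i. 0 < i \<Longrightarrow> real i / 2 \<le> mean_len (t * i)"
  shows "0 < walk_drift G S \<mu>"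
proof -
  have "strict_mono (\<lambda>i. t * Suc i)" using t by (simp add: strict_mono_Suc_iff)
  from LIMSEQ_subseq_LIMSEQ[OF mean_len_limit(1) this]
  have "(\<lambda>i. mean_len (t * Suc i) / real (t * Suc i)) \<longlonglongrightarrow> walk_drift G S \<mu>"
    by (simp add: o_def)
  moreover have "1 / (2 * real t) \<le> mean_len (t * Suc i) / real (t * Suc i)" for i
  proof -
    have "1 / (2 * real t) = (real (Suc i) / 2) / real (t * Suc i)"
      using t(1) by (simp only: of_nat_mult) (simp del: of_nat_Suc)
    also have "\<dots> \<le> mean_len (t * Suc i) / real (t * Suc i)"
      by (intro divide_right_mono t(2)) auto
    finally show ?thesis .
  qed
  ultimately have "1 / (2 * real t) \<le> walk_drift G S \<mu>"
    by (intro LIMSEQ_le_const) auto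
  moreover have "0 < 1 / (2 * real t)" using t(1) by simp
  ultimately show ?thesis by linarith
qed

text \<open>The fundamental inequality between entropy, drift and growth.  If \<open>c\<close> exceeds the growth rate,
  the weights \<open>exp (- c * len x)\<close> have a finite sum \<open>Z\<close>, and comparing the law with the probability
  measure proportional to them bounds its entropy by \<open>c\<close> times its mean length plus \<open>ln Z\<close>.\<close>

lemma entropy_le_weight:
  fixes c :: real
  assumes summable: "summable (\<lambda>k. card (word_sphere G S k) * exp (- (c * real k)))"
  obtains K where "\<And>n. ent n \<le> c * mean_len n + K"
proof -
  define Z where "Z = (\<Sum>k. card (word_sphere G S k) * exp (- (c * real k)))"
  define q where "q x = exp (- (c * real (len x)))" for x
  have total_le: "(\<Sum>x\<in>A. q x) \<le> Z" if A: "finite A" "A \<subseteq> carrier G" for A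
  proof -
    obtain N where N: "\<forall>x\<in>A. len x < N"
      using finite_nat_set_iff_bounded[of "len ` A"] A(1) by auto
    have fin: "finite (\<Union>k<N. word_sphere G S k)"
      by (intro finite_UN_I finite_word_sphere) auto
    have "(\<Sum>x\<in>A. q x) \<le> (\<Sum>x\<in>(\<Union>k<N. word_sphere G S k). q x)"
      using A N by (intro sum_mono2 fin) (auto simp: q_def word_sphere_def)
    also have "\<dots> = (\<Sum>k<N. \<Sum>x\<in>word_sphere G S k. q x)"
      by (intro sum.UNION_disjoint ballI finite_word_sphere) (auto simp: word_sphere_def)
    also have "\<dots> = (\<Sum>k<N. card (word_sphere G S k) * exp (- (c * real k)))"
      by (intro sum.cong refl) (simp add: q_def word_sphere_def)
    also have "\<dots> \<le> Z"
      unfolding Z_def by (intro sum_le_suminf summable) auto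
    finally show ?thesis .
  qed
  have "q \<one> \<le> Z" using total_le[of "{\<one>}"] by simp
  moreover have "0 < q \<one>" by (simp add: q_def)
  ultimately have Z: "0 < Z" by linarith
  have "ent n \<le> c * mean_len n + ln Z" for n
  proof -
    let ?p = "pmf (law n)"
    have "ent n \<le> measure_pmf.expectation (law n) (\<lambda>x. (c * real (len x) + ln Z - 1) + q x / (Z * ?p x))"
      unfolding ent_def
    proof (intro integral_mono_AE integrable_law)
      have "- ln (?p x) \<le> (c * real (len x) + ln Z - 1) + q x / (Z * ?p x)" if x: "x \<in> set_pmf (law n)" for x
      proof -
        have px: "0 < ?p x" using x by (simp add: pmf_positive)
        have "ln (q x / (Z * ?p x)) \<le> q x / (Z * ?p x) - 1"
          using px Z by (intro ln_le_minus_one) (simp add: q_def)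
        moreover have "ln (q x / (Z * ?p x)) = - (c * len x) - ln Z - ln (?p x)"
          using px Z by (simp add: ln_div ln_mult q_def)
        ultimately show ?thesis by linarith
      qed
      then show "AE x in law n. - ln (?p x) \<le> (c * real (len x) + ln Z - 1) + q x / (Z * ?p x)"
        by (auto simp: AE_measure_pmf_iff)
    qed
    also have "\<dots> = c * mean_len n + ln Z - 1 + measure_pmf.expectation (law n) (\<lambda>x. q x / (Z * ?p x))"
      by (simp add: mean_len_def)
    also have "measure_pmf.expectation (law n) (\<lambda>x. q x / (Z * ?p x)) = (\<Sum>x\<in>set_pmf (law n). q x / Z)"
      by (subst integral_measure_pmf_real[of "set_pmf (law n)"]) (auto intro!: sum.cong simp: set_pmf_iff)
    also have "\<dots> \<le> 1"
      using total_le[of "set_pmf (law n)"] set_law_carrier Z by (simp add: sum_divide_distrib[symmetric])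
    finally show ?thesis by simp
  qed
  then show ?thesis by (rule that)
qed

lemma card_word_sphere_pos:
  assumes "infinite (carrier G)"
  shows "0 < card (word_sphere G S n)"
proof -
  obtain x where "x \<in> carrier G" "len x = n" using assms by (rule unbounded_len)
  then have "x \<in> word_sphere G S n" by (simp add: word_sphere_def)
  then show ?thesis using finite_word_sphere card_gt_0_iff by blast
qed

lemma card_word_sphere_mult:
  "card (word_sphere G S (m + n)) \<le> card (word_sphere G S m) * card (word_sphere G S n)"
proof -
  have "word_sphere G S (m + n) \<subseteq> (\<lambda>(x, y). x \<otimes> y) ` (word_sphere G S m \<times> word_sphere G S n)"
  proof
    fix x assume "x \<in> word_sphere G S (m + n)"
    then have x: "x \<in> carrier G" "len x = m + n" by (auto simp: word_sphere_def)
    obtain y z where "y \<in> carrier G" "z \<in> carrier G" "x = y \<otimes> z" "len y = m" "len z = len x - m"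
      by (rule len_split[OF x(1), of m]) (use x(2) in auto)
    then show "x \<in> (\<lambda>(x, y). x \<otimes> y) ` (word_sphere G S m \<times> word_sphere G S n)"
      using x(2) by (intro image_eqI[of _ _ "(y, z)"]) (auto simp: word_sphere_def)
  qed
  from surj_card_le[OF _ this] show ?thesis by (simp add: card_cartesian_product)
qed

text \<open>The growth rate is the infimum of \<open>ln (card (word_sphere G S n)) / n\<close>, so that the fundamental
  inequality holds with each of these numbers.\<close>

lemma entropy_le_drift_growth:
  assumes inf: "infinite (carrier G)" and n: "0 < n"
  shows "walk_entropy G \<mu> \<le> ln (card (word_sphere G S n)) / n * walk_drift G S \<mu>"
proof -
  let ?s = "\<lambda>n. card (word_sphere G S n)"
  have pos: "0 < ?s n" for n using inf by (rule card_word_sphere_pos)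
  have "word_sphere G S 0 = {\<one>}"
    using len_eq_0 by (auto simp: word_sphere_def)
  then have zero: "ln (real (?s 0)) = 0" by simp
  have sub: "ln (real (?s (m + n))) \<le> ln (real (?s m)) + ln (real (?s n))" for m n
  proof -
    have "ln (real (?s (m + n))) \<le> ln (real (?s m * ?s n))"
      using pos[of "m + n"] card_word_sphere_mult[of m n]
      by (intro ln_mono) (simp_all only: of_nat_le_iff of_nat_0_less_iff)
    also have "\<dots> = ln (real (?s m)) + ln (real (?s n))"
      using pos[of m] pos[of n] unfolding of_nat_mult by (intro ln_mult_pos) (simp_all only: of_nat_0_less_iff)
    finally show ?thesis .
  qed
  have nonneg: "0 \<le> ln (real (?s n))" for n
    using pos[of n] by (intro ln_ge_zero) linarith
  obtain v where v: "(\<lambda>n. ln (real (?s n)) / n) \<longlonglongrightarrow> v" "\<And>n. 0 < n \<Longrightarrow> v \<le> ln (real (?s n)) / n"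
    using zero sub nonneg by (rule subadditive_limit[of "\<lambda>n. ln (real (?s n))"]) blast
  have "walk_entropy G \<mu> \<le> c * walk_drift G S \<mu>" if c: "v < c" for c :: real
  proof -
    define d where "d = (v + c) / 2"
    have d: "v < d" "d < c" using c by (auto simp: d_def)
    have "\<forall>\<^sub>F k in sequentially. ln (real (?s k)) / k < d \<and> 0 < k"
      using d v(1) by (intro eventually_conj order_tendstoD(2) eventually_gt_at_top)
    then have "\<forall>\<^sub>F k in sequentially. norm (?s k * exp (- (c * real k))) \<le> exp (d - c) ^ k"
    proof eventually_elim
      case (elim k)
      then have "ln (real (?s k)) \<le> d * k" by (intro less_imp_le) (auto simp: pos_divide_less_eq)
      then have "exp (ln (real (?s k))) \<le> exp (d * k)" by (simp only: exp_le_cancel_iff)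
      moreover have "exp (ln (real (?s k))) = ?s k"
        using pos[of k] by (intro exp_ln) (simp only: of_nat_0_less_iff)
      ultimately have "real (?s k) \<le> exp (d * k)" by simp
      then have "?s k * exp (- (c * real k)) \<le> exp (d * k) * exp (- (c * k))"
        by (intro mult_right_mono) auto
      also have "\<dots> = exp (d - c) ^ k"
        by (simp add: exp_add[symmetric] exp_of_nat_mult[symmetric] algebra_simps)
      finally show ?case by simp
    qed
    moreover have "summable (\<lambda>k. exp (d - c) ^ k)"
      using d by (intro summable_geometric) auto
    ultimately have "summable (\<lambda>k. ?s k * exp (- (c * real k)))"
      by (rule summable_comparison_test_ev)
    then obtain K where K: "\<And>n. ent n \<le> c * mean_len n + K"
      by (rule entropy_le_weight) blast
    have "(\<lambda>n. c * (mean_len n / n) + K / n) \<longlonglongrightarrow> c * walk_drift G S \<mu> + 0"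
      by (intro tendsto_intros mean_len_limit lim_const_over_n)
    moreover have "ent n / n \<le> c * (mean_len n / n) + K / n" for n
      using divide_right_mono[OF K[of n], of "real n"] by (simp add: add_divide_distrib)
    ultimately show ?thesis
      using LIMSEQ_le[OF ent_limit(1)] by auto
  qed
  then have "walk_entropy G \<mu> \<le> v * walk_drift G S \<mu>"
  proof -
    have "(\<lambda>k. (v + 1 / real (Suc k)) * walk_drift G S \<mu>) \<longlonglongrightarrow> (v + 0) * walk_drift G S \<mu>"
      by (intro tendsto_intros LIMSEQ_Suc[OF lim_1_over_n])
    moreover have "walk_entropy G \<mu> \<le> (v + 1 / real (Suc k)) * walk_drift G S \<mu>" for k
      using \<open>\<And>c. v < c \<Longrightarrow> walk_entropy G \<mu> \<le> c * walk_drift G S \<mu>\<close> by simp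
    ultimately show ?thesis by (auto intro: LIMSEQ_le_const)
  qed
  also have "\<dots> \<le> ln (real (?s n)) / n * walk_drift G S \<mu>"
    using v(2)[OF n] walk_drift_nonneg by (intro mult_right_mono)
  finally show ?thesis .
qed

lemma card_word_sphere_ge:
  assumes inf: "infinite (carrier G)" and pos: "0 < walk_drift G S \<mu>"
  shows "exp (walk_entropy G \<mu> / walk_drift G S \<mu>) ^ n \<le> card (word_sphere G S n)"
proof (cases "n = 0")
  case False
  have ne: "0 < card (word_sphere G S n)" using inf by (rule card_word_sphere_pos)
  have "walk_entropy G \<mu> / walk_drift G S \<mu> \<le> ln (card (word_sphere G S n)) / n"
    using entropy_le_drift_growth[OF inf, of n] False pos by (simp add: pos_divide_le_eq)
  then have "n * (walk_entropy G \<mu> / walk_drift G S \<mu>) \<le> ln (card (word_sphere G S n))"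
    using False by (simp add: pos_le_divide_eq mult.commute)
  then have "exp (n * (walk_entropy G \<mu> / walk_drift G S \<mu>)) \<le> exp (ln (card (word_sphere G S n)))"
    unfolding exp_le_cancel_iff .
  also have "\<dots> = card (word_sphere G S n)"
    using ne by (intro exp_ln) (simp only: of_nat_0_less_iff)
  finally show ?thesis by (simp only: exp_of_nat_mult)
next
  case True
  have "word_sphere G S 0 = {\<one>}"
    using len_eq_0 by (auto simp: word_sphere_def)
  then show ?thesis using True by simp
qed

end

section \<open>The path space\<close>

context word_metric
begin

lemma countable_carrier: "countable (carrier G)"
proof -
  have "carrier G = (\<Union>n. ball n)" by (auto simp: ball_def)
  then show ?thesis by (metis countable_UN countable_finite countableI_type finite_ball)
qed

text \<open>The product of the \<open>n\<close> increments from index \<open>j\<close> on, that is the displacement of the walk between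
  times \<open>j\<close> and \<open>j + n\<close>.  For \<open>j = 0\<close> it is the walk itself.\<close>

definition block :: "(nat \<Rightarrow> 'a) \<Rightarrow> nat \<Rightarrow> nat \<Rightarrow> 'a" where
  "block X j n = list_prod G (map X [j..<j + n])"

lemma walk_eq_block: "walk G X n = block X 0 n"
  by (simp add: walk_def block_def)

lemma block_closed: "(\<And>i. X i \<in> carrier G) \<Longrightarrow> block X j n \<in> carrier G"
  unfolding block_def by (intro list_prod_closed) auto

lemma block_add:
  assumes "\<And>i. X i \<in> carrier G"
  shows "block X j (m + n) = block X j m \<otimes> block X (j + m) n"
proof -
  have "map X [j..<j + (m + n)] = map X [j..<j + m] @ map X [j + m..<j + m + n]"
    using upt_add_eq_append[of j "j + m" n] by (simp add: add.assoc)
  then show ?thesis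
    unfolding block_def using assms by (simp add: list_prod_append image_subset_iff)
qed

lemma block_0: "block X j 0 = \<one>" and block_1: "X j \<in> carrier G \<Longrightarrow> block X j (Suc 0) = X j"
  by (simp_all add: block_def)

lemma block_shift: "block (\<lambda>k. X (k + i)) j n = block X (j + i) n"
proof -
  have "map (\<lambda>k. X (k + i)) [j..<j + n] = map X [j + i..<j + i + n]"
    by (induction n) (auto simp: add_ac)
  then show ?thesis by (simp add: block_def)
qed

lemma block_shift_0: "block (\<lambda>k. X (k + i)) 0 = block X i"
  by (rule ext) (simp add: block_shift)

end

context word_metric_walk
begin

abbreviation step :: "'a measure" where
  "step \<equiv> restrict_space (measure_pmf \<mu>) (carrier G)"

abbreviation paths :: "(nat \<Rightarrow> 'a) measure" where
  "paths \<equiv> increments G \<mu>"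

lemma space_step: "space step = carrier G"
  by (simp add: space_restrict_space)

lemma sets_step: "sets step = Pow (carrier G)"
  by (auto simp: sets_restrict_space)

lemma prob_space_step: "prob_space step"
proof (rule prob_space_restrict_space)
  show "emeasure (measure_pmf \<mu>) (carrier G) = 1"
    using support_carrier by (subst measure_pmf.emeasure_eq_1_AE) (auto simp: AE_measure_pmf_iff)
qed simp

sublocale steps: sequence_space step
proof -
  interpret prob_space step by (rule prob_space_step)
  show "sequence_space step" by unfold_locales
qed

lemma paths_eq: "paths = steps.S"
  by (simp add: increments_def)

sublocale P: prob_space paths
  unfolding paths_eq by unfold_locales

lemma space_paths: "space paths = {X. \<forall>i. X i \<in> carrier G}"
  by (auto simp: paths_eq space_PiM space_step PiE_iff)

lemma coordinate_measurable: "(\<lambda>X. X i) \<in> measurable paths step"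
  unfolding paths_eq by measurable

text \<open>Stated for any measurable structure \<open>N\<close> that makes the coordinates from \<open>j\<close> on measurable, so as to
  apply both to the path space and to its tail.\<close>

lemma block_measurable:
  assumes N: "space N \<subseteq> space paths" "\<And>i. j \<le> i \<Longrightarrow> (\<lambda>X. X i) \<in> measurable N step"
  shows "(\<lambda>X. block X j n) \<in> measurable N (count_space (carrier G))"
proof (induction n)
  case 0
  show ?case by (simp add: block_0)
next
  case (Suc n)
  have "(\<lambda>X. x \<otimes> X (j + n)) \<in> measurable N (count_space (carrier G))" if x: "x \<in> carrier G" for x
  proof (rule measurable_compose[OF N(2)[of "j + n"]])
    show "(\<otimes>) x \<in> measurable step (count_space (carrier G))"
      using x by (intro measurableI) (auto simp: space_step sets_step)
  qed simp
  from measurable_compose_countable'[OF this Suc countable_carrier]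
  have "(\<lambda>X. block X j n \<otimes> X (j + n)) \<in> measurable N (count_space (carrier G))" .
  moreover have "block X j (Suc n) = block X j n \<otimes> X (j + n)" if "X \<in> space N" for X
    using that N(1) block_add[of X j n 1] by (auto simp: space_paths block_1 subset_iff)
  ultimately show ?case by (subst measurable_cong) auto
qed

lemma block_measurable_paths [measurable]:
  "(\<lambda>X. block X j n) \<in> measurable paths (count_space (carrier G))"
  by (intro block_measurable coordinate_measurable order_refl)

lemma block_measurable_UNIV [measurable]:
  "(\<lambda>X. block X j n) \<in> measurable paths (count_space UNIV)"
  by (rule measurable_compose[OF block_measurable_paths]) (simp add: measurable_count_space_eq1)

lemma block_event [measurable]: "{X \<in> space paths. block X j n \<in> A} \<in> sets paths"
proof -
  have "(\<lambda>X. block X j n) -` A \<inter> space paths \<in> sets paths"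
    using block_measurable_UNIV by (rule measurable_sets) simp
  then show ?thesis by (simp add: vimage_def Int_def conj_commute)
qed

lemma shift_measurable: "(\<lambda>X k. X (k + i)) \<in> measurable paths paths"
  unfolding paths_eq by (intro measurable_PiM_single') (auto simp: space_PiM PiE_iff space_step)

lemma distr_shift: "distr paths paths (\<lambda>X k. X (k + i)) = paths"
  using distr_PiM_reindex[of UNIV "\<lambda>_. step" "\<lambda>k. k + i" UNIV] prob_space_step
  by (simp add: paths_eq restrict_UNIV)

lemma prob_block_shift:
  assumes "Measurable.pred paths (\<lambda>X. Q (\<lambda>n. block X 0 n))"
  shows "P.prob {X \<in> space paths. Q (\<lambda>n. block X i n)} = P.prob {X \<in> space paths. Q (\<lambda>n. block X 0 n)}"
proof -
  have "P.prob {X \<in> space paths. Q (\<lambda>n. block X 0 n)}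
      = measure (distr paths paths (\<lambda>X k. X (k + i))) {X \<in> space paths. Q (\<lambda>n. block X 0 n)}"
    by (simp add: distr_shift)
  also have "\<dots> = P.prob ((\<lambda>X k. X (k + i)) -` {X \<in> space paths. Q (\<lambda>n. block X 0 n)} \<inter> space paths)"
    using assms by (intro measure_distr shift_measurable) (simp add: pred_def)
  also have "(\<lambda>X k. X (k + i)) -` {X \<in> space paths. Q (\<lambda>n. block X 0 n)} \<inter> space paths
      = {X \<in> space paths. Q (\<lambda>n. block X i n)}"
    by (auto simp: space_paths block_shift_0)
  finally show ?thesis ..
qed

text \<open>Splitting off the first increment identifies the law of the position at time \<open>n\<close>.\<close>

lemma emeasure_block: "emeasure paths {X \<in> space paths. block X 0 n \<in> A} = emeasure (law n) A"
proof (induction n arbitrary: A)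
  case 0
  have "{X \<in> space paths. block X 0 0 \<in> A} = (if \<one> \<in> A then space paths else {})"
    by (auto simp: block_0)
  then show ?case by (simp add: P.emeasure_space_1 indicator_def)
next
  case (Suc n)
  let ?E = "{X \<in> space paths. block X 0 (Suc n) \<in> A}"
  let ?f = "\<lambda>(s, X). case_nat s X"
  have E: "?E \<in> sets paths" by (rule block_event)
  have f: "?f \<in> measurable (step \<Otimes>\<^sub>M paths) paths"
    unfolding paths_eq by measurable
  have "emeasure paths ?E = emeasure (distr (step \<Otimes>\<^sub>M paths) paths ?f) ?E"
    using steps.PiM_iter by (simp add: paths_eq)
  also have "\<dots> = emeasure (step \<Otimes>\<^sub>M paths) (?f -` ?E \<inter> space (step \<Otimes>\<^sub>M paths))"
    using f E by (rule emeasure_distr)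
  also have "\<dots> = (\<integral>\<^sup>+s. emeasure paths (Pair s -` (?f -` ?E \<inter> space (step \<Otimes>\<^sub>M paths))) \<partial>step)"
    using f E by (intro P.emeasure_pair_measure_alt measurable_sets)
  also have "\<dots> = (\<integral>\<^sup>+s. emeasure (law n) ((\<otimes>) s -` A) \<partial>step)"
  proof (rule nn_integral_cong)
    fix s assume "s \<in> space step"
    then have s: "s \<in> carrier G" by (simp add: space_step)
    have "block (case_nat s X) 0 (Suc n) = s \<otimes> block X 0 n" if X: "X \<in> space paths" for X
    proof -
      have c: "case_nat s X i \<in> carrier G" for i
        using s X by (auto simp: space_paths split: nat.split)
      have "block (case_nat s X) 0 (Suc n) = block (case_nat s X) 0 1 \<otimes> block (case_nat s X) 1 n"
        using block_add[where X = "case_nat s X" and j = 0 and m = 1 and n = n, OF c] by simp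
      also have "block (case_nat s X) 1 n = block X 0 n"
        using block_shift[of "case_nat s X" 1 0 n] by simp
      finally show ?thesis using s by (simp add: block_1)
    qed
    then have "Pair s -` (?f -` ?E \<inter> space (step \<Otimes>\<^sub>M paths)) = {X \<in> space paths. block X 0 n \<in> (\<otimes>) s -` A}"
      using s by (auto simp: space_pair_measure space_step space_paths split: nat.split)
    then show "emeasure paths (Pair s -` (?f -` ?E \<inter> space (step \<Otimes>\<^sub>M paths))) = emeasure (law n) ((\<otimes>) s -` A)"
      by (simp only: Suc)
  qed
  also have "\<dots> = (\<integral>\<^sup>+s. emeasure (law n) ((\<otimes>) s -` A) * indicator (carrier G) s \<partial>\<mu>)"
    by (intro nn_integral_restrict_space) simp
  also have "\<dots> = (\<integral>\<^sup>+s. emeasure (law n) ((\<otimes>) s -` A) \<partial>\<mu>)"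
    using support_carrier by (intro nn_integral_cong_AE) (auto simp: AE_measure_pmf_iff)
  also have "\<dots> = emeasure (bind_pmf \<mu> (\<lambda>s. map_pmf ((\<otimes>) s) (law n))) A"
    by simp
  also have "bind_pmf \<mu> (\<lambda>s. map_pmf ((\<otimes>) s) (law n)) = law (Suc n)"
  proof -
    have "law 1 = map_pmf (\<lambda>g. \<one> \<otimes> g) \<mu>"
      by (simp add: conv_power.simps(2) pair_return_pmf1 map_pmf_comp)
    also have "\<dots> = map_pmf id \<mu>"
      using support_carrier by (intro map_pmf_cong) auto
    finally have "law 1 = \<mu>" by simp
    then show ?thesis
      using law_add[of 1 n] by (simp add: pair_pmf_def map_pmf_def bind_assoc_pmf bind_return_pmf)
  qed
  finally show ?case .
qed

lemma distr_block: "distr paths (count_space UNIV) (\<lambda>X. block X 0 n) = measure_pmf (law n)"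
proof (rule measure_eqI)
  fix A assume "A \<in> sets (distr paths (count_space UNIV) (\<lambda>X. block X 0 n))"
  have "emeasure (distr paths (count_space UNIV) (\<lambda>X. block X 0 n)) A
      = emeasure paths ((\<lambda>X. block X 0 n) -` A \<inter> space paths)"
    by (intro emeasure_distr) measurable
  also have "(\<lambda>X. block X 0 n) -` A \<inter> space paths = {X \<in> space paths. block X 0 n \<in> A}" by auto
  finally show "emeasure (distr paths (count_space UNIV) (\<lambda>X. block X 0 n)) A = emeasure (law n) A"
    by (simp add: emeasure_block)
qed simp

lemma prob_block: "P.prob {X \<in> space paths. block X 0 n \<in> A} = measure (law n) A"
  by (simp add: measure_def emeasure_block)

lemma expectation_block: "P.expectation (\<lambda>X. real (len (block X 0 n))) = mean_len n"
proof -
  have "mean_len n = integral\<^sup>L (distr paths (count_space UNIV) (\<lambda>X. block X 0 n)) (\<lambda>x. real (len x))"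
    by (simp add: mean_len_def distr_block)
  also have "\<dots> = P.expectation (\<lambda>X. real (len (block X 0 n)))"
    by (intro integral_distr) measurable
  finally show ?thesis ..
qed

lemma AE_steps_support: "AE X in paths. \<forall>i. X i \<in> set_pmf \<mu>"
proof (subst AE_all_countable, intro allI)
  fix i
  have "AE x in step. x \<in> set_pmf \<mu>"
    by (subst AE_restrict_space_iff) (auto simp: AE_measure_pmf_iff)
  then show "AE X in paths. X i \<in> set_pmf \<mu>"
    unfolding paths_eq by (intro steps.AE_component) auto
qed

lemma AE_block_support: "AE X in paths. \<forall>n. block X 0 n \<in> set_pmf (law n)"
proof (subst AE_all_countable, intro allI)
  fix n
  have "AE x in distr paths (count_space UNIV) (\<lambda>X. block X 0 n). x \<in> set_pmf (law n)"
    unfolding distr_block by (simp add: AE_measure_pmf_iff)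
  then show "AE X in paths. block X 0 n \<in> set_pmf (law n)"
    by (rule AE_distrD[OF block_measurable_UNIV])
qed

lemma prob_walk_law:
  "measure (walk_law G \<mu>) {x \<in> space (walk_law G \<mu>). \<forall>n. x n \<in> A} = P.prob {X \<in> space paths. \<forall>n. block X 0 n \<in> A}"
proof -
  let ?Q = "\<Pi>\<^sub>M n\<in>(UNIV :: nat set). count_space (carrier G)"
  have w: "walk G \<in> measurable paths ?Q"
    by (intro measurable_PiM_single') (auto simp: walk_eq_block space_paths block_closed)
  have comp: "(\<lambda>x. x n) -` (A \<inter> carrier G) \<inter> space ?Q \<in> sets ?Q" for n
    by (rule measurable_sets[OF measurable_component_singleton]) auto
  have "{x \<in> space ?Q. \<forall>n. x n \<in> A} = (\<Inter>n. (\<lambda>x. x n) -` (A \<inter> carrier G) \<inter> space ?Q)"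
    by (auto simp: space_PiM PiE_iff)
  also have "\<dots> \<in> sets ?Q"
    by (rule sets.countable_INT'[OF _ _ image_subsetI[OF comp]]) auto
  finally have m: "{x \<in> space ?Q. \<forall>n. x n \<in> A} \<in> sets ?Q" .
  have "measure (walk_law G \<mu>) {x \<in> space (walk_law G \<mu>). \<forall>n. x n \<in> A}
      = P.prob (walk G -` {x \<in> space ?Q. \<forall>n. x n \<in> A} \<inter> space paths)"
    unfolding walk_law_def using w m by (simp add: measure_distr)
  also have "walk G -` {x \<in> space ?Q. \<forall>n. x n \<in> A} \<inter> space paths = {X \<in> space paths. \<forall>n. block X 0 n \<in> A}"
    using measurable_space[OF w] by (auto simp: walk_eq_block)
  finally show ?thesis .
qed

end

section \<open>The almost sure lower bound for the speed\<close>

context word_metric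
begin

text \<open>Asking the deficit \<open>c * n - len (block X j n)\<close> to be unbounded, rather than comparing the lower
  limit of \<open>len (block X j n) / n\<close> with \<open>c\<close>, makes the independence of \<open>j\<close> immediate.\<close>

definition slow :: "real \<Rightarrow> (nat \<Rightarrow> 'a) \<Rightarrow> nat \<Rightarrow> bool" where
  "slow c X j \<longleftrightarrow> (\<forall>K::nat. \<exists>n. real (len (block X j n) + K) < c * real n)"

lemma slow_iff:
  assumes X: "\<And>i. X i \<in> carrier G" and c: "0 \<le> c"
  shows "slow c X j \<longleftrightarrow> slow c X 0"
proof -
  let ?D = "len (block X 0 j)"
  have split: "block X 0 (j + n) = block X 0 j \<otimes> block X j n" for n
    using block_add[where X = X and j = 0 and m = j and n = n, OF X] by simp
  have up: "len (block X 0 (j + n)) \<le> ?D + len (block X j n)" for n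
    unfolding split using X by (intro len_mult block_closed)
  have down: "len (block X j n) \<le> ?D + len (block X 0 (j + n))" for n
  proof -
    have "block X j n = inv (block X 0 j) \<otimes> block X 0 (j + n)"
      unfolding split using block_closed[of X 0 j, OF X] block_closed[of X j n, OF X]
      by (simp add: m_assoc[symmetric])
    then show ?thesis
      using len_mult[of "inv (block X 0 j)" "block X 0 (j + n)"] block_closed[of X, OF X] by simp
  qed
  show ?thesis
  proof
    assume slow: "slow c X j"
    show "slow c X 0" unfolding slow_def
    proof
      fix K :: nat
      obtain n where "real (len (block X j n) + (K + ?D)) < c * n"
        using slow unfolding slow_def by blast
      moreover have "c * n \<le> c * (j + n)" using c by (intro mult_left_mono) auto
      ultimately have "real (len (block X 0 (j + n)) + K) < c * (j + n)"
        using up[of n] by linarith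
      then show "\<exists>n. real (len (block X 0 n) + K) < c * n" by blast
    qed
  next
    assume slow: "slow c X 0"
    show "slow c X j" unfolding slow_def
    proof
      fix K :: nat
      obtain m where m: "real (len (block X 0 m) + (K + ?D + nat \<lceil>c * j\<rceil>)) < c * m"
        using slow unfolding slow_def by blast
      have cj: "c * j \<le> nat \<lceil>c * j\<rceil>" by linarith
      have "j \<le> m"
      proof (rule ccontr)
        assume "\<not> j \<le> m"
        then have "c * m \<le> c * j" using c by (intro mult_left_mono) auto
        with m cj show False by linarith
      qed
      then obtain n where n: "m = j + n" using le_Suc_ex by blast
      have "c * m = c * j + c * n" unfolding n by (simp add: algebra_simps)
      with m cj down[of n] have "real (len (block X j n) + K) < c * n" unfolding n by linarith
      then show "\<exists>n. real (len (block X j n) + K) < c * n" by blast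
    qed
  qed
qed

definition stuck :: "real \<Rightarrow> nat \<Rightarrow> (nat \<Rightarrow> 'a) \<Rightarrow> bool" where
  "stuck c M x \<longleftrightarrow> (\<forall>r\<in>{1..M}. c * real r \<le> real (len (x r)))"

text \<open>Cover the time interval from left to right: where a block of length at most \<open>M\<close> and speed less than
  \<open>c\<close> starts, use that block, and use a single step otherwise.  The last term accounts for the end of
  the interval, where a block may not fit in.\<close>

lemma len_block_covering:
  assumes X: "\<And>i. X i \<in> carrier G" "\<And>i. len (X i) \<le> K" and c: "0 \<le> c"
  shows "len (block X j n) \<le> c * n + real K * card {i \<in> {j..<j + n}. stuck c M (block X i)} + real K * M"
proof (induction n arbitrary: j rule: less_induct)
  case (less n)
  let ?B = "\<lambda>j n. {i \<in> {j..<j + n}. stuck c M (block X i)}"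
  have trivial: "len (block X j n) \<le> K * n" for j n
    using len_list_prod_le[of "map X [j..<j + n]" K] X by (auto simp: block_def)
  consider "n \<le> M" | "M < n" "stuck c M (block X j)" | "M < n" "\<not> stuck c M (block X j)"
    by linarith
  then show ?case
  proof cases
    case 1
    have "real (len (block X j n)) \<le> real (K * n)" using trivial by (rule of_nat_mono)
    also have "\<dots> \<le> real K * M" using 1 by (simp add: mult_left_mono)
    finally show ?thesis using c by (simp add: add_increasing)
  next
    case 2
    obtain n' where n: "n = 1 + n'" using 2 by (cases n) auto
    have "block X j n = X j \<otimes> block X (j + 1) n'"
      using block_add[where X = X and j = j and m = 1 and n = n', OF X(1)] X(1)
      unfolding n by (simp add: block_1)
    then have "len (block X j n) \<le> len (X j) + len (block X (j + 1) n')"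
      using len_mult[of "X j" "block X (j + 1) n'"] X(1) block_closed[of X "j + 1" n', OF X(1)] by simp
    also have "\<dots> \<le> K + len (block X (j + 1) n')" using X(2) by simp
    finally have "real (len (block X j n)) \<le> K + real (len (block X (j + 1) n'))" by linarith
    also have "\<dots> \<le> K + (c * n' + real K * card (?B (j + 1) n') + real K * M)"
      using less[of n' "j + 1"] n by simp
    also have "\<dots> \<le> c * n + real K * card (?B j n) + real K * M"
    proof -
      have "?B j n = insert j (?B (j + 1) n')"
        using 2(2) n by (auto simp: le_Suc_eq Suc_le_eq le_less)
      then have "card (?B j n) = Suc (card (?B (j + 1) n'))" by simp
      then show ?thesis using n c by (simp add: algebra_simps)
    qed
    finally show ?thesis .
  next
    case 3
    then obtain r where r: "1 \<le> r" "r \<le> M" "len (block X j r) < c * r"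
      by (auto simp: stuck_def not_le)
    then have rn: "r < n" using 3 by simp
    define n' where "n' = n - r"
    have n: "n = r + n'" using rn by (simp add: n'_def)
    have "len (block X j n) \<le> len (block X j r) + len (block X (j + r) n')"
      unfolding n block_add[where X = X and j = j and m = r and n = n', OF X(1)]
      by (intro len_mult block_closed X(1))
    then have "real (len (block X j n)) \<le> c * r + real (len (block X (j + r) n'))"
      using r(3) by linarith
    also have "\<dots> \<le> c * r + (c * n' + real K * card (?B (j + r) n') + real K * M)"
      using less[of n' "j + r"] n r by simp
    also have "\<dots> \<le> c * n + real K * card (?B j n) + real K * M"
    proof -
      have "card (?B (j + r) n') \<le> card (?B j n)"
        using n by (intro card_mono) auto
      then have "real K * card (?B (j + r) n') \<le> real K * card (?B j n)"
        by (intro mult_left_mono) auto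
      then show ?thesis unfolding n by (simp add: algebra_simps)
    qed
    finally show ?thesis .
  qed
qed

end

context word_metric_walk
begin

lemma slow_measurable:
  assumes N: "space N = space paths" "\<And>i. j \<le> i \<Longrightarrow> (\<lambda>X. X i) \<in> measurable N step"
  shows "{X \<in> space paths. slow c X j} \<in> sets N"
proof -
  have "{X \<in> space paths. real (len (block X j n) + K) < c * real n} \<in> sets N" for n K :: nat
  proof -
    have "(\<lambda>X. block X j n) -` {x \<in> carrier G. real (len x + K) < c * real n} \<inter> space N \<in> sets N"
      using N by (intro measurable_sets[OF block_measurable]) auto
    moreover have "(\<lambda>X. block X j n) -` {x \<in> carrier G. real (len x + K) < c * real n} \<inter> space N
        = {X \<in> space paths. real (len (block X j n) + K) < c * real n}"
      using N(1) by (auto simp: space_paths block_closed)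
    ultimately show ?thesis by simp
  qed
  then have "(\<Inter>K::nat. \<Union>n. {X \<in> space paths. real (len (block X j n) + K) < c * real n}) \<in> sets N"
    by (intro sets.countable_INT' sets.countable_UN' image_subsetI) auto
  moreover have "(\<Inter>K::nat. \<Union>n. {X \<in> space paths. real (len (block X j n) + K) < c * real n}) = {X \<in> space paths. slow c X j}"
    by (auto simp: slow_def)
  ultimately show ?thesis by simp
qed

lemma slow_event: "{X \<in> space paths. slow c X j} \<in> sets paths"
  by (intro slow_measurable coordinate_measurable refl)

lemma indep_coordinates: "P.indep_vars (\<lambda>_. step) (\<lambda>i X. X i) UNIV"
proof (subst P.indep_vars_iff_distr_eq_PiM')
  show "P.random_variable step (\<lambda>X. X i)" for i by (rule coordinate_measurable)
  have "distr paths step (\<lambda>X. X i) = step" for i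
    unfolding paths_eq using steps.PiM_component[of i] by simp
  then show "distr paths (\<Pi>\<^sub>M i\<in>UNIV. step) (\<lambda>X. \<lambda>i\<in>UNIV. X i)
      = (\<Pi>\<^sub>M i\<in>UNIV. distr paths step (\<lambda>X. X i))"
    by (simp add: restrict_UNIV paths_eq[symmetric] distr_id2)
qed auto

text \<open>By \<open>slow_iff\<close> the increments before any given time do not matter, so that being slow is a tail
  event.\<close>

lemma prob_slow_0_1:
  assumes c: "0 \<le> c"
  shows "P.prob {X \<in> space paths. slow c X 0} = 0 \<or> P.prob {X \<in> space paths. slow c X 0} = 1"
proof -
  define A where "A i = sigma_sets (space paths) {(\<lambda>X. X i) -` B \<inter> space paths | B. B \<in> sets step}" for i :: nat
  have "P.indep_sets A UNIV"
    using indep_coordinates unfolding P.indep_vars_def A_def by blast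
  moreover have sigma: "sigma_algebra (space paths) (A i)" for i
    unfolding A_def by (intro sigma_algebra_sigma_sets) auto
  moreover have "{X \<in> space paths. slow c X 0} \<in> P.tail_events A"
    unfolding P.tail_events_def
  proof
    fix j :: nat
    define N where "N = sigma (space paths) (\<Union> (A ` {j..}))"
    have "A i \<subseteq> Pow (space paths)" for i
    proof
      fix B assume "B \<in> A i"
      then have "B \<in> sigma_sets (space paths) {(\<lambda>X. X i) -` B \<inter> space paths | B. B \<in> sets step}"
        by (simp add: A_def)
      from sigma_sets_into_sp[OF _ this] show "B \<in> Pow (space paths)" by auto
    qed
    then have sub: "\<Union> (A ` {j..}) \<subseteq> Pow (space paths)" by blast
    have N: "space N = space paths" "sets N = sigma_sets (space paths) (\<Union> (A ` {j..}))"
      using sub by (simp_all add: N_def space_measure_of sets_measure_of)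
    have coord: "(\<lambda>X. X i) \<in> measurable N step" if "j \<le> i" for i
    proof (rule measurableI)
      fix B assume B: "B \<in> sets step"
      then have "(\<lambda>X. X i) -` B \<inter> space paths \<in> A i" unfolding A_def by blast
      with that show "(\<lambda>X. X i) -` B \<inter> space N \<in> sets N" unfolding N by blast
    qed (simp add: N space_paths space_step)
    have "{X \<in> space paths. slow c X 0} = {X \<in> space paths. slow c X j}"
      using slow_iff[OF _ c] by (auto simp: space_paths)
    also have "\<dots> \<in> sigma_sets (space paths) (\<Union> (A ` {j..}))"
      unfolding N(2)[symmetric] using N(1) coord by (rule slow_measurable)
    finally show "{X \<in> space paths. slow c X 0} \<in> sigma_sets (space paths) (\<Union> (A ` {j..}))" .
  qed
  ultimately show ?thesis by (intro P.kolmogorov_0_1_law)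
qed

lemma stuck_event: "{X \<in> space paths. stuck c M (block X i)} \<in> sets paths"
proof -
  have "{X \<in> space paths. stuck c M (block X i)}
      = space paths \<inter> (\<Inter>r\<in>{1..M}. {X \<in> space paths. block X i r \<in> {x. c * real r \<le> real (len x)}})"
    by (auto simp: stuck_def)
  also have "\<dots> \<in> sets paths"
    by (cases "M = 0") (auto intro!: sets.Int sets.finite_INT block_event)
  finally show ?thesis .
qed

lemma prob_stuck: "P.prob {X \<in> space paths. stuck c M (block X i)} = P.prob {X \<in> space paths. stuck c M (block X 0)}"
  using prob_block_shift[of "stuck c M" i] stuck_event[of c M 0] by (simp add: pred_def)

lemma mean_len_covering:
  assumes c: "0 \<le> c"
  obtains K :: real where "\<And>n M. mean_len n \<le> c * n + K * n * P.prob {X \<in> space paths. stuck c M (block X 0)} + K * M"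
proof -
  define k where "k = Max (len ` set_pmf \<mu>)"
  define K where "K = real k"
  have k: "len x \<le> k" if "x \<in> set_pmf \<mu>" for x
    unfolding k_def using that finite_support by (intro Max_ge) auto
  let ?E = "\<lambda>M i. {X \<in> space paths. stuck c M (block X i)}"
  have "mean_len n \<le> c * n + K * n * P.prob (?E M 0) + K * M" for n M
  proof -
    have "mean_len n = P.expectation (\<lambda>X. real (len (block X 0 n)))"
      by (rule expectation_block[symmetric])
    also have "\<dots> \<le> P.expectation (\<lambda>X. (c * n + K * M) + K * (\<Sum>i<n. indicator (?E M i) X))"
    proof (rule integral_mono_AE)
      have "integrable (distr paths (count_space UNIV) (\<lambda>X. block X 0 n)) (\<lambda>x. real (len x))"
        unfolding distr_block by simp
      then show "integrable paths (\<lambda>X. real (len (block X 0 n)))"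
        by (subst (asm) integrable_distr_eq) auto
      show "integrable paths (\<lambda>X. (c * n + K * M) + K * (\<Sum>i<n. indicator (?E M i) X))"
        using stuck_event by (intro Bochner_Integration.integrable_add integrable_mult_right
          Bochner_Integration.integrable_sum integrable_real_indicator)
          (auto simp: P.emeasure_eq_measure)
      show "AE X in paths. real (len (block X 0 n)) \<le> (c * n + K * M) + K * (\<Sum>i<n. indicator (?E M i) X)"
        using AE_steps_support
      proof (rule AE_mp, intro AE_I2 impI)
        fix X assume X: "X \<in> space paths" "\<forall>i. X i \<in> set_pmf \<mu>"
        have "(\<Sum>i<n. indicator (?E M i) X :: real) = card {i \<in> {..<n}. stuck c M (block X i)}"
          using X(1) by (simp add: indicator_def Collect_conj_eq Int_commute lessThan_def)
        moreover have "real (len (block X 0 n))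
            \<le> c * n + real k * card {i \<in> {0..<0 + n}. stuck c M (block X i)} + real k * M"
          using X k by (intro len_block_covering c) (auto simp: space_paths)
        ultimately show "real (len (block X 0 n)) \<le> (c * n + K * M) + K * (\<Sum>i<n. indicator (?E M i) X)"
          by (simp add: atLeast0LessThan K_def)
      qed
    qed
    also have "\<dots> = (c * n + K * M) + K * (\<Sum>i<n. P.prob (?E M i))"
    proof -
      have ind: "integrable paths (indicator (?E M i) :: _ \<Rightarrow> real)" for i
        using stuck_event by (intro integrable_real_indicator) (auto simp: P.emeasure_eq_measure)
      have "?E M i \<inter> space paths = ?E M i" for i by blast
      then have "P.expectation (indicator (?E M i)) = P.prob (?E M i)" for i
        by (simp only: Bochner_Integration.integral_indicator)
      then have "P.expectation (\<lambda>X. \<Sum>i<n. indicator (?E M i) X) = (\<Sum>i<n. P.prob (?E M i))"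
        using ind by (simp only: Bochner_Integration.integral_sum)
      moreover have "P.expectation (\<lambda>X. (c * n + K * M) + K * (\<Sum>i<n. indicator (?E M i) X))
          = P.expectation (\<lambda>X. c * n + K * M) + P.expectation (\<lambda>X. K * (\<Sum>i<n. indicator (?E M i) X))"
        by (intro Bochner_Integration.integral_add P.integrable_const integrable_mult_right
            Bochner_Integration.integrable_sum ind)
      ultimately show ?thesis by (simp only: integral_mult_right_zero integral_const) (simp add: P.prob_space)
    qed
    also have "\<dots> = c * n + K * n * P.prob (?E M 0) + K * M"
    proof -
      have "(\<Sum>i<n. P.prob (?E M i)) = (\<Sum>i<n. P.prob (?E M 0))"
        by (intro sum.cong refl prob_stuck)
      then show ?thesis by simp
    qed
    finally show ?thesis .
  qed
  then show ?thesis by (rule that)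
qed

text \<open>Otherwise blocks of speed less than \<open>c\<close> would start at almost every time, and for large \<open>M\<close> most of
  them would have length at most \<open>M\<close>; the covering bound would then give a drift of at most \<open>c\<close>.\<close>

lemma prob_slow_eq_0:
  assumes c: "0 \<le> c" "c < walk_drift G S \<mu>"
  shows "P.prob {X \<in> space paths. slow c X 0} = 0"
proof (rule ccontr)
  let ?l = "walk_drift G S \<mu>"
  let ?E = "\<lambda>M. {X \<in> space paths. stuck c M (block X 0)}"
  assume "P.prob {X \<in> space paths. slow c X 0} \<noteq> 0"
  then have "P.prob {X \<in> space paths. slow c X 0} = 1"
    using prob_slow_0_1[OF c(1)] by blast
  then have ae: "AE X in paths. X \<in> {X \<in> space paths. slow c X 0}"
    using slow_event by (subst (asm) P.prob_eq_1) auto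
  obtain K where K: "\<And>n M. mean_len n \<le> c * n + K * n * P.prob (?E M) + K * M"
    by (rule mean_len_covering[OF c(1)]) blast
  have "?l \<le> c + K * P.prob (?E M)" for M
  proof -
    have "(\<lambda>n. c + K * P.prob (?E M) + (K * M) / real n) \<longlonglongrightarrow> c + K * P.prob (?E M) + 0"
      by (intro tendsto_intros lim_const_over_n)
    moreover have "mean_len n / n \<le> c + K * P.prob (?E M) + (K * M) / real n" if "0 < n" for n
      using K(1)[of n M] that by (simp add: field_simps)
    then have "\<exists>N. \<forall>n\<ge>N. mean_len n / n \<le> c + K * P.prob (?E M) + (K * M) / real n"
      by (intro exI[of _ 1]) auto
    ultimately show ?thesis
      using LIMSEQ_le[OF mean_len_limit(1)] by simp
  qed
  moreover have "(\<lambda>M. c + K * P.prob (?E M)) \<longlonglongrightarrow> c + K * P.prob (\<Inter>M. ?E M)"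
    using stuck_event
    by (intro tendsto_intros P.finite_Lim_measure_decseq) (auto simp: decseq_def stuck_def)
  ultimately have "?l \<le> c + K * P.prob (\<Inter>M. ?E M)"
    by (intro LIMSEQ_le_const) auto
  moreover have "P.prob (\<Inter>M. ?E M) = 0"
  proof -
    have "AE X in paths. X \<notin> (\<Inter>M. ?E M)"
      using ae
    proof (rule AE_mp, intro AE_I2 impI)
      fix X assume "X \<in> {X \<in> space paths. slow c X 0}"
      then obtain n where n: "real (len (block X 0 n) + 0) < c * n" unfolding slow_def by blast
      then have "0 < n" by (cases n) auto
      with n have "\<not> stuck c n (block X 0)" by (auto simp: stuck_def not_le intro!: bexI[of _ n])
      then show "X \<notin> (\<Inter>M. ?E M)" by auto
    qed
    then show ?thesis
      using stuck_event by (subst P.prob_eq_0) (auto intro!: sets.countable_INT')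
  qed
  ultimately show False using c by simp
qed

lemma AE_speed_ge:
  assumes \<epsilon>: "0 < \<epsilon>" and pos: "0 < walk_drift G S \<mu>"
  shows "AE X in paths. \<forall>\<^sub>F n in sequentially. (walk_drift G S \<mu> - \<epsilon>) * n \<le> len (block X 0 n)"
proof -
  let ?l = "walk_drift G S \<mu>"
  \<comment> \<open>Any speed strictly between \<open>?l - \<epsilon>\<close> and \<open>?l\<close> that is also positive.\<close>
  define c where "c = max (?l / 2) (?l - \<epsilon> / 2)"
  have c: "0 < c" "c < ?l" "?l - \<epsilon> < c" using \<epsilon> pos by (auto simp: c_def)
  have "AE X in paths. X \<notin> {X \<in> space paths. slow c X 0}"
    using prob_slow_eq_0[of c] c slow_event by (subst (asm) P.prob_eq_0) auto
  then show ?thesis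
  proof (rule AE_mp, intro AE_I2 impI)
    fix X assume "X \<in> space paths" "X \<notin> {X \<in> space paths. slow c X 0}"
    then obtain K :: nat where K: "\<And>n. c * n \<le> len (block X 0 n) + K"
      by (auto simp: slow_def not_less)
    have "\<forall>\<^sub>F n :: nat in sequentially. K / (c - (?l - \<epsilon>)) \<le> n"
      by (rule eventually_sequentiallyI[of "nat \<lceil>K / (c - (?l - \<epsilon>))\<rceil>"]) linarith
    then show "\<forall>\<^sub>F n in sequentially. (?l - \<epsilon>) * n \<le> len (block X 0 n)"
    proof eventually_elim
      case (elim n)
      then have "K \<le> (c - (?l - \<epsilon>)) * n" using c by (simp add: pos_divide_le_eq mult.commute)
      then show ?case using K[of n] by (simp add: algebra_simps)
    qed
  qed
qed

end

section \<open>The random walk and the sets that contain it\<close>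

lemma (in prob_space) AE_eventually_uniform:
  assumes Q: "\<And>n::nat. {x \<in> space M. Q n x} \<in> events"
    and ae: "AE x in M. \<forall>\<^sub>F n in sequentially. Q n x" and \<delta>: "0 < \<delta>"
  obtains N where "prob {x \<in> space M. \<exists>n\<ge>N. \<not> Q n x} < \<delta>"
proof -
  let ?B = "\<lambda>N. {x \<in> space M. \<exists>n\<ge>N. \<not> Q n x}"
  have B: "?B N \<in> events" for N
  proof -
    have "?B N = (\<Union>n\<in>{N..}. space M - {x \<in> space M. Q n x})" by auto
    also have "\<dots> \<in> events" using Q by (intro sets.countable_UN') auto
    finally show ?thesis .
  qed
  have "(\<lambda>N. prob (?B N)) \<longlonglongrightarrow> prob (\<Inter>N. ?B N)"
  proof (rule finite_Lim_measure_decseq)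
    show "range ?B \<subseteq> events" using B by blast
    show "decseq ?B" by (auto simp: decseq_def intro: order_trans)
  qed
  moreover have "prob (\<Inter>N. ?B N) = 0"
  proof -
    have "AE x in M. x \<notin> (\<Inter>N. ?B N)"
      using ae
    proof (rule AE_mp, intro AE_I2 impI)
      fix x assume "\<forall>\<^sub>F n in sequentially. Q n x"
      then obtain N where "\<forall>n\<ge>N. Q n x" unfolding eventually_sequentially by blast
      then show "x \<notin> (\<Inter>N. ?B N)" by blast
    qed
    moreover have "(\<Inter>N. ?B N) \<in> events"
      by (intro sets.countable_INT' image_subsetI B) auto
    ultimately show ?thesis using prob_eq_0 by blast
  qed
  ultimately have "\<forall>\<^sub>F N in sequentially. prob (?B N) < \<delta>"
    using \<delta> by (intro order_tendstoD(2)) auto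
  then obtain N where "prob (?B N) < \<delta>"
    using eventually_happens'[OF sequentially_bot] by blast
  then show ?thesis by (rule that)
qed

context word_metric_walk
begin

definition good :: "real \<Rightarrow> nat \<Rightarrow> 'a set" where
  "good \<epsilon> n = {x \<in> typical \<epsilon> n. (walk_drift G S \<mu> - \<epsilon>) * real n \<le> real (len x)}"

lemma AE_good:
  assumes \<epsilon>: "0 < \<epsilon>" and pos: "0 < walk_drift G S \<mu>"
  shows "AE X in paths. \<forall>\<^sub>F n in sequentially. block X 0 n \<in> good \<epsilon> n"
proof -
  let ?A = "\<lambda>n. {X \<in> space paths. block X 0 n \<in> - typical \<epsilon> n}"
  have "AE X in paths. \<forall>\<^sub>F n in sequentially. X \<in> space paths - ?A n"
  proof (rule borel_cantelli_AE1)
    show "?A n \<in> sets paths" for n by (rule block_event)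
    show "emeasure paths (?A n) < \<infinity>" for n by (simp add: P.emeasure_eq_measure)
    show "summable (\<lambda>n. P.prob (?A n))"
      unfolding prob_block using \<epsilon> by (rule summable_not_typical)
  qed
  then show ?thesis
    using AE_speed_ge[OF assms]
  proof eventually_elim
    case (elim X)
    then show ?case by eventually_elim (simp add: good_def)
  qed
qed

text \<open>The positions that respect the precision \<open>1 / Suc j\<close> from time \<open>T j\<close> on, for every \<open>j\<close>.\<close>

definition confined :: "(nat \<Rightarrow> nat) \<Rightarrow> 'a set" where
  "confined T = {x. \<exists>n. x \<in> set_pmf (law n) \<and> (\<forall>j. T j \<le> n \<longrightarrow> x \<in> good (1 / real (Suc j)) n)}"

lemma confined_carrier: "confined T \<subseteq> carrier G"
  by (auto simp: confined_def dest: law_carrier)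

text \<open>For each \<open>j\<close> choose \<open>T j\<close> so late that the walk violates the precision \<open>1 / Suc j\<close> after that time with
  probability less than \<open>a / 2 ^ Suc j\<close>.\<close>

lemma exists_confined:
  assumes a: "0 < a" and pos: "0 < walk_drift G S \<mu>"
  obtains T where "1 - a \<le> P.prob {X \<in> space paths. \<forall>n. block X 0 n \<in> confined T}"
proof -
  let ?B = "\<lambda>j N. {X \<in> space paths. \<exists>n\<ge>N. block X 0 n \<notin> good (1 / real (Suc j)) n}"
  let ?a = "\<lambda>j. a * (1 / 2) ^ Suc j"
  have "\<forall>j. \<exists>N. P.prob (?B j N) < ?a j"
  proof
    fix j
    have "AE X in paths. \<forall>\<^sub>F n in sequentially. block X 0 n \<in> good (1 / real (Suc j)) n"
      by (rule AE_good[OF _ pos]) simp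
    moreover have "0 < ?a j" using a by simp
    ultimately obtain N where "P.prob (?B j N) < ?a j"
      by (rule P.AE_eventually_uniform[OF block_event])
    then show "\<exists>N. P.prob (?B j N) < ?a j" ..
  qed
  from choice[OF this] obtain T where T: "\<And>j. P.prob (?B j (T j)) < ?a j" by blast
  have B: "?B j N \<in> sets paths" for j N
  proof -
    have "?B j N = (\<Union>n\<in>{N..}. {X \<in> space paths. block X 0 n \<in> - good (1 / real (Suc j)) n})" by auto
    also have "\<dots> \<in> sets paths" by (intro sets.countable_UN' image_subsetI block_event) auto
    finally show ?thesis .
  qed
  have sums: "?a sums a"
    using sums_mult[OF power_half_series, of a] by simp
  have sum: "summable (\<lambda>j. P.prob (?B j (T j)))"
    using T sums_summable[OF sums] by (intro summable_comparison_test'[OF sums_summable[OF sums], of 0])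
      (auto intro: less_imp_le)
  have "P.prob (\<Union>j. ?B j (T j)) \<le> (\<Sum>j. P.prob (?B j (T j)))"
    using B sum by (intro P.finite_measure_subadditive_countably) auto
  also have "\<dots> \<le> (\<Sum>j. ?a j)"
    using T by (intro suminf_le sum sums_summable[OF sums] less_imp_le)
  also have "\<dots> = a" using sums by (rule sums_unique[symmetric])
  finally have small: "P.prob (\<Union>j. ?B j (T j)) \<le> a" .
  have U: "(\<Union>j. ?B j (T j)) \<in> sets paths" using B by (intro sets.countable_UN) auto
  have "1 - a \<le> P.prob (space paths - (\<Union>j. ?B j (T j)))"
    using small P.prob_compl[OF U] by simp
  also have "\<dots> \<le> P.prob {X \<in> space paths. \<forall>n. block X 0 n \<in> confined T}"
  proof (rule P.finite_measure_mono_AE)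
    show "AE X in paths. X \<in> space paths - (\<Union>j. ?B j (T j)) \<longrightarrow> X \<in> {X \<in> space paths. \<forall>n. block X 0 n \<in> confined T}"
      using AE_block_support by (rule AE_mp) (auto simp: confined_def intro!: AE_I2)
    have "{X \<in> space paths. \<forall>n. block X 0 n \<in> confined T} = (\<Inter>n. {X \<in> space paths. block X 0 n \<in> confined T})"
      by auto
    also have "\<dots> \<in> sets paths" by (intro sets.countable_INT' image_subsetI block_event) auto
    finally show "{X \<in> space paths. \<forall>n. block X 0 n \<in> confined T} \<in> sets paths" .
  qed
  finally show ?thesis by (rule that)
qed

text \<open>If an element of length \<open>m\<close> is good at time \<open>n\<close>, then \<open>n\<close> is at most \<open>m / (l - \<epsilon> j)\<close>, and there are
  few typical elements up to this time.  The constant \<open>C\<close> accounts for the finitely many positions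
  before time \<open>T j\<close>.\<close>

lemma card_confined:
  defines "h \<equiv> walk_entropy G \<mu>" and "l \<equiv> walk_drift G S \<mu>" and "\<epsilon> \<equiv> \<lambda>j. 1 / real (Suc j)"
  assumes j: "\<epsilon> j < l"
  obtains C :: real where "\<And>m. card (confined T \<inter> word_sphere G S m)
    \<le> C + (m / (l - \<epsilon> j) + 1) * exp (m * ((h + \<epsilon> j) / (l - \<epsilon> j)))"
proof -
  define F where "F = (\<Union>n<T j. set_pmf (law n))"
  have F: "finite F" by (simp add: F_def)
  have e: "0 < \<epsilon> j" by (simp add: \<epsilon>_def)
  have h: "0 \<le> h" unfolding h_def by (rule walk_entropy_nonneg)
  have "card (confined T \<inter> word_sphere G S m)
      \<le> card F + (m / (l - \<epsilon> j) + 1) * exp (m * ((h + \<epsilon> j) / (l - \<epsilon> j)))" for m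
  proof -
    let ?n = "nat \<lfloor>m / (l - \<epsilon> j)\<rfloor>"
    have fin: "finite (typical (\<epsilon> j) n)" for n
      by (rule finite_subset[OF _ finite_set_law[of n]]) (auto simp: typical_def)
    have n_le: "n \<le> m / (l - \<epsilon> j)" if "n \<le> ?n" for n
      using that j by (simp add: le_nat_iff le_floor_iff)
    have "confined T \<inter> word_sphere G S m \<subseteq> F \<union> (\<Union>n\<le>?n. typical (\<epsilon> j) n)"
    proof
      fix x assume x: "x \<in> confined T \<inter> word_sphere G S m"
      then obtain n where n: "x \<in> set_pmf (law n)" "T j \<le> n \<Longrightarrow> x \<in> good (\<epsilon> j) n"
        unfolding confined_def \<epsilon>_def by blast
      show "x \<in> F \<union> (\<Union>n\<le>?n. typical (\<epsilon> j) n)"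
      proof (cases "T j \<le> n")
        case True
        with n have g: "x \<in> typical (\<epsilon> j) n" "(l - \<epsilon> j) * n \<le> m"
          using x by (auto simp: good_def l_def word_sphere_def)
        then have "n \<le> m / (l - \<epsilon> j)" using j by (simp add: pos_le_divide_eq mult.commute)
        then have "n \<le> ?n" using j by (simp add: le_nat_iff le_floor_iff)
        then show ?thesis using g by blast
      next
        case False
        then show ?thesis using n(1) by (auto simp: F_def)
      qed
    qed
    then have "card (confined T \<inter> word_sphere G S m) \<le> card (F \<union> (\<Union>n\<le>?n. typical (\<epsilon> j) n))"
      using F fin by (intro card_mono) auto
    also have "\<dots> \<le> card F + card (\<Union>n\<le>?n. typical (\<epsilon> j) n)" by (rule card_Un_le)
    also have "\<dots> \<le> card F + (\<Sum>n\<le>?n. card (typical (\<epsilon> j) n))"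
      by (intro add_left_mono card_UN_le) auto
    finally have "real (card (confined T \<inter> word_sphere G S m)) \<le> card F + (\<Sum>n\<le>?n. real (card (typical (\<epsilon> j) n)))"
      by (simp only: of_nat_le_iff of_nat_add[symmetric] of_nat_sum[symmetric])
    also have "\<dots> \<le> card F + (\<Sum>n\<le>?n. exp (m * ((h + \<epsilon> j) / (l - \<epsilon> j))))"
    proof (intro add_left_mono sum_mono)
      fix n assume "n \<in> {..?n}"
      then have "n * (h + \<epsilon> j) \<le> m / (l - \<epsilon> j) * (h + \<epsilon> j)"
        using h e by (intro mult_right_mono n_le) auto
      then have "exp (n * (h + \<epsilon> j)) \<le> exp (m * ((h + \<epsilon> j) / (l - \<epsilon> j)))" by simp
      then show "card (typical (\<epsilon> j) n) \<le> exp (m * ((h + \<epsilon> j) / (l - \<epsilon> j)))"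
        using card_typical[of "\<epsilon> j" n] unfolding h_def by linarith
    qed
    also have "\<dots> = card F + (real ?n + 1) * exp (m * ((h + \<epsilon> j) / (l - \<epsilon> j)))" by simp
    also have "\<dots> \<le> card F + (m / (l - \<epsilon> j) + 1) * exp (m * ((h + \<epsilon> j) / (l - \<epsilon> j)))"
      using n_le[of ?n] by (intro add_left_mono mult_right_mono) auto
    finally show ?thesis .
  qed
  then show ?thesis by (rule that)
qed

text \<open>Adding exactly as many elements of each sphere as the limit requires cannot spoil the upper
  bound, and it makes the lower bound trivial.  The fundamental inequality provides the elements.\<close>

lemma exists_growth_set:
  assumes inf: "infinite (carrier G)" and pos: "0 < walk_drift G S \<mu>"
    and upper: "\<And>j. 1 / real (Suc j) < walk_drift G S \<mu> \<Longrightarrow> \<exists>C::real. \<forall>m. card (U \<inter> word_sphere G S m)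
      \<le> C + (m / (walk_drift G S \<mu> - 1 / real (Suc j)) + 1)
        * exp (m * ((walk_entropy G \<mu> + 1 / real (Suc j)) / (walk_drift G S \<mu> - 1 / real (Suc j))))"
  shows "\<exists>V\<subseteq>carrier G. (\<lambda>m. root m (card ((U \<union> V) \<inter> word_sphere G S m)))
    \<longlonglongrightarrow> exp (walk_entropy G \<mu> / walk_drift G S \<mu>)"
proof -
  let ?h = "walk_entropy G \<mu>" and ?l = "walk_drift G S \<mu>"
  let ?E = "exp (?h / ?l)" and ?S = "word_sphere G S"
  have E: "1 \<le> ?E" using walk_entropy_nonneg pos by simp
  have "\<exists>W. W \<subseteq> ?S m \<and> card W = nat \<lceil>?E ^ m\<rceil>" for m
  proof -
    have "nat \<lceil>?E ^ m\<rceil> \<le> card (?S m)"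
      using card_word_sphere_ge[OF inf pos, of m] by (simp add: nat_le_iff ceiling_le_iff)
    then show ?thesis
      using obtain_subset_with_card_n by metis
  qed
  then obtain W where W: "\<And>m. W m \<subseteq> ?S m" "\<And>m. card (W m) = nat \<lceil>?E ^ m\<rceil>" by metis
  define V where "V = (\<Union>m. W m)"
  have V: "V \<inter> ?S m = W m" for m
    using W(1) unfolding V_def word_sphere_def by blast
  define c where "c m = card ((U \<union> V) \<inter> ?S m)" for m
  have split: "(U \<union> V) \<inter> ?S m = (U \<inter> ?S m) \<union> W m" for m
    using V by blast
  have lower: "?E ^ m \<le> c m" for m
  proof -
    have "?E ^ m \<le> nat \<lceil>?E ^ m\<rceil>" by linarith
    also have "\<dots> \<le> c m"
      unfolding c_def split W(2)[symmetric] of_nat_le_iff using finite_subset[OF W(1)] by (intro card_mono) auto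
    finally show ?thesis .
  qed
  have root_upper: "\<forall>\<^sub>F m in sequentially. root m (c m) \<le> exp ((?h + e) / (?l - e) + e)"
    if e: "e = 1 / real (Suc j)" "e < ?l" for e j
  proof -
    let ?r = "(?h + e) / (?l - e)"
    have e0: "0 < e" by (simp add: e)
    obtain C :: real where C: "\<And>m. card (U \<inter> ?S m) \<le> C + (m / (?l - e) + 1) * exp (m * ?r)"
      using upper[of j] e by auto
    have r: "?h / ?l \<le> ?r"
      using walk_entropy_nonneg e e0 by (intro frac_le) auto
    have "((\<lambda>m::nat. (A + B * real m) / exp (e * real m)) \<longlongrightarrow> 0) at_top" for A B :: real
      using e0 by real_asymp
    from order_tendstoD(2)[OF this[of "\<bar>C\<bar> + 3" "1 / (?l - e)"] zero_less_one]
    show ?thesis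
      using eventually_gt_at_top[of 0]
    proof eventually_elim
      case (elim m)
      have ge1: "1 \<le> exp (m * ?r)"
        using r walk_entropy_nonneg pos e e0 by (intro one_le_exp_iff[THEN iffD2] mult_nonneg_nonneg divide_nonneg_nonneg) auto
      have "?E ^ m = exp (m * (?h / ?l))" by (rule exp_of_nat_mult[symmetric])
      also have "\<dots> \<le> exp (m * ?r)"
        unfolding exp_le_cancel_iff using r by (intro mult_left_mono) auto
      finally have Em: "?E ^ m \<le> exp (m * ?r)" .
      have "real (c m) \<le> card (U \<inter> ?S m) + real (card (W m))"
        unfolding c_def split of_nat_add[symmetric] of_nat_le_iff by (rule card_Un_le)
      also have "\<dots> \<le> card (U \<inter> ?S m) + (?E ^ m + 1)"
        unfolding W(2) using zero_le_power[OF exp_ge_zero, of "?h / ?l" m] by linarith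
      also have "\<dots> \<le> (C + (m / (?l - e) + 1) * exp (m * ?r)) + (exp (m * ?r) + 1)"
        by (intro add_mono C Em order_refl)
      also have "\<dots> \<le> (\<bar>C\<bar> + 3 + 1 / (?l - e) * m) * exp (m * ?r)"
      proof -
        define y where "y = exp (m * ?r)"
        have "C \<le> \<bar>C\<bar> * y" and "1 \<le> y"
          using ge1 mult_left_mono[OF ge1, of "\<bar>C\<bar>"] unfolding y_def by linarith+
        then show ?thesis unfolding y_def[symmetric] by (simp add: distrib_right)
      qed
      also have "\<dots> \<le> exp (e * m) * exp (m * ?r)"
        using elim(1) by (intro mult_right_mono) (simp_all add: divide_less_eq)
      also have "\<dots> = exp (?r + e) ^ m"
        by (simp only: mult_exp_exp exp_of_nat_mult[symmetric]) (simp add: algebra_simps)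
      finally have "root m (c m) \<le> root m (exp (?r + e) ^ m)"
        using elim(2) by (intro real_root_le_mono)
      also have "\<dots> = exp (?r + e)"
        using elim(2) by (intro real_root_power_cancel) auto
      finally show ?case .
    qed
  qed
  have "(\<lambda>m. root m (c m)) \<longlonglongrightarrow> ?E"
  proof (rule order_tendstoI)
    fix y assume y: "y < ?E"
    show "\<forall>\<^sub>F m in sequentially. y < root m (c m)"
      using eventually_gt_at_top[of 0]
    proof eventually_elim
      case (elim m)
      have "?E = root m (?E ^ m)" using elim by (intro real_root_power_cancel[symmetric]) auto
      also have "\<dots> \<le> root m (c m)" using elim lower by (intro real_root_le_mono)
      finally show ?case using y by simp
    qed
  next
    fix y assume y: "?E < y"
    let ?e = "\<lambda>j. 1 / real (Suc j)"
    have e: "?e \<longlonglongrightarrow> 0" by (rule LIMSEQ_Suc[OF lim_1_over_n])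
    have "(\<lambda>j. exp ((?h + ?e j) / (?l - ?e j) + ?e j)) \<longlonglongrightarrow> exp ((?h + 0) / (?l - 0) + 0)"
      using pos by (intro tendsto_intros e) auto
    then have "\<forall>\<^sub>F j in sequentially. exp ((?h + ?e j) / (?l - ?e j) + ?e j) < y"
      using y by (intro order_tendstoD(2)) auto
    moreover have "\<forall>\<^sub>F j in sequentially. ?e j < ?l"
      using e pos by (intro order_tendstoD(2))
    ultimately have "\<forall>\<^sub>F j in sequentially. exp ((?h + ?e j) / (?l - ?e j) + ?e j) < y \<and> ?e j < ?l"
      by (rule eventually_conj)
    then obtain j where j: "exp ((?h + ?e j) / (?l - ?e j) + ?e j) < y" "?e j < ?l"
      using eventually_happens'[OF sequentially_bot] by blast
    show "\<forall>\<^sub>F m in sequentially. root m (c m) < y"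
      using root_upper[OF refl j(2)] by eventually_elim (use j(1) in linarith)
  qed
  moreover have "V \<subseteq> carrier G"
    using W(1) unfolding V_def word_sphere_def by blast
  ultimately show ?thesis unfolding c_def by blast
qed

lemma confining_set:
  assumes inf: "infinite (carrier G)" and pos: "0 < walk_drift G S \<mu>" and a: "0 < a"
  shows "\<exists>\<Gamma>\<subseteq>carrier G.
    1 - a \<le> measure (walk_law G \<mu>) {x \<in> space (walk_law G \<mu>). \<forall>n. x n \<in> \<Gamma>} \<and>
    (\<lambda>n. root n (card (\<Gamma> \<inter> word_sphere G S n))) \<longlonglongrightarrow> exp (walk_entropy G \<mu> / walk_drift G S \<mu>)"
proof -
  obtain T where T: "1 - a \<le> P.prob {X \<in> space paths. \<forall>n. block X 0 n \<in> confined T}"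
    using a pos by (rule exists_confined)
  have "\<exists>V\<subseteq>carrier G. (\<lambda>m. root m (card ((confined T \<union> V) \<inter> word_sphere G S m)))
      \<longlonglongrightarrow> exp (walk_entropy G \<mu> / walk_drift G S \<mu>)"
    using inf pos
  proof (rule exists_growth_set)
    fix j assume j: "1 / real (Suc j) < walk_drift G S \<mu>"
    show "\<exists>C::real. \<forall>m. card (confined T \<inter> word_sphere G S m)
        \<le> C + (m / (walk_drift G S \<mu> - 1 / real (Suc j)) + 1)
          * exp (m * ((walk_entropy G \<mu> + 1 / real (Suc j)) / (walk_drift G S \<mu> - 1 / real (Suc j))))"
      by (rule card_confined[OF j, of T], rule exI, rule allI)
  qed
  then obtain V where V: "V \<subseteq> carrier G" "(\<lambda>m. root m (card ((confined T \<union> V) \<inter> word_sphere G S m)))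
      \<longlonglongrightarrow> exp (walk_entropy G \<mu> / walk_drift G S \<mu>)"
    by (elim exE conjE)
  have event: "{X \<in> space paths. \<forall>n. block X 0 n \<in> A} \<in> sets paths" for A
  proof -
    have "{X \<in> space paths. \<forall>n. block X 0 n \<in> A} = (\<Inter>n. {X \<in> space paths. block X 0 n \<in> A})" by auto
    also have "\<dots> \<in> sets paths" by (intro sets.countable_INT' image_subsetI block_event) auto
    finally show ?thesis .
  qed
  have "P.prob {X \<in> space paths. \<forall>n. block X 0 n \<in> confined T}
      \<le> P.prob {X \<in> space paths. \<forall>n. block X 0 n \<in> confined T \<union> V}"
    by (intro P.finite_measure_mono event) auto
  with T have "1 - a \<le> measure (walk_law G \<mu>) {x \<in> space (walk_law G \<mu>). \<forall>n. x n \<in> confined T \<union> V}"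
    unfolding prob_walk_law by linarith
  with V confined_carrier show ?thesis
    by (intro exI[of _ "confined T \<union> V"]) auto
qed

end

text \<open>The generating set \<open>S\<close> for which the drift is computed may differ from the generating set \<open>S'\<close>
  whose word metric is hyperbolic; the latter only serves to prove non-amenability.\<close>

lemma hyperbolic_walk_drift_pos:
  fixes G :: "('a, 'b) monoid_scheme" (structure)
  assumes "word_metric_walk G S \<mu>" and hyp: "hyperbolic_group G" and "\<not> elementary_group G"
    and adm: "admissible G \<mu>"
  shows "0 < walk_drift G S \<mu>"
proof -
  interpret W: word_metric_walk G S \<mu> by fact
  obtain S' \<delta> where S': "finite_symmetric_generating G S'"
    and \<delta>: "\<forall>w\<in>carrier G. \<forall>x\<in>carrier G. \<forall>y\<in>carrier G. \<forall>z\<in>carrier G.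
      min (gromov_product (word_dist G S') w x y) (gromov_product (word_dist G S') w y z) - \<delta>
        \<le> gromov_product (word_dist G S') w x z"
    using hyp unfolding hyperbolic_group_def gromov_hyperbolic_on_def by blast
  interpret M: word_metric G S' by unfold_locales fact
  have gp: "gromov_product (word_dist G S') \<one> x y = M.gp x y" if "x \<in> carrier G" "y \<in> carrier G" for x y
    using that by (simp add: gromov_product_def word_dist_def M.gp_def)
  interpret H: hyperbolic_word_metric G S' \<delta>
  proof unfold_locales
    show four: "min (M.gp x y) (M.gp y z) \<le> M.gp x z + \<delta>"
      if "x \<in> carrier G" "y \<in> carrier G" "z \<in> carrier G" for x y z
      using \<delta>[rule_format, of \<one> x y z] that by (simp add: gp)
    show "0 \<le> \<delta>" using four[of \<one> \<one> \<one>] by (simp add: M.gp_def)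
  qed
  have "carrier G \<subseteq> {list_prod G w | w. set w \<subseteq> set_pmf \<mu>}"
    using adm unfolding admissible_def by blast
  then obtain m :: nat where m: "\<And>F. (\<forall>x. 0 \<le> F x) \<Longrightarrow> W.mass F < \<infinity> \<Longrightarrow>
      W.mass F \<le> of_nat m * (\<Sum>g\<in>set_pmf \<mu>. W.mass (\<lambda>x. \<bar>F (x \<otimes> g) - F x\<bar>))"
    using H.nonamenable[OF assms(3) W.finite_support W.support_carrier] by blast
  obtain L r where "0 < L" "0 < r" "r < 1" "\<And>n. W.energy (n + L) \<le> r * W.energy n"
    by (rule W.energy_contraction[OF m]) blast+
  then obtain t where "0 < t" "\<And>i. 0 < i \<Longrightarrow> real i / 2 \<le> W.mean_len (t * i)"
    by (rule W.mean_len_ge) blast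
  then show ?thesis by (rule W.walk_drift_pos)
qed

theorem theorem1p3:
  fixes G :: "('a, 'b) monoid_scheme" and S :: "'a set" and \<mu> :: "'a pmf" and a :: real
  assumes "group G"
    and "hyperbolic_group G"
    and "\<not> elementary_group G"
    and "finite_symmetric_generating G S"
    and "prob_on_group G \<mu>"
    and "finite (set_pmf \<mu>)"
    and "admissible G \<mu>"
    and "0 < a" and "a < 1"
  shows "\<exists>\<Gamma>\<^sub>a \<subseteq> carrier G.
    measure (walk_law G \<mu>) {x \<in> space (walk_law G \<mu>). \<forall>n. x n \<in> \<Gamma>\<^sub>a} \<ge> 1 - a \<and>
    (\<lambda>n. root n (real (card (\<Gamma>\<^sub>a \<inter> word_sphere G S n))))
      \<longlonglongrightarrow> exp (walk_entropy G \<mu> / walk_drift G S \<mu>)"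
proof -
  interpret group G by fact
  have walk: "word_metric_walk G S \<mu>"
    using assms by unfold_locales (simp_all add: prob_on_group_def)
  then have "0 < walk_drift G S \<mu>"
    using assms by (intro hyperbolic_walk_drift_pos)
  moreover have "infinite (carrier G)"
    using assms finite_imp_elementary by blast
  ultimately show ?thesis
    using word_metric_walk.confining_set[OF walk] \<open>0 < a\<close> by blast
qed

end
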